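(* For any Misiurewicz parameter $c_0\in\mathbb{M}$ of the quadratic family $f_c(z)=z^2+c$, the sets $\mathcal{Z}_{c_0}(c_0)$ and $\mathcal{P}(c_0)$ share at least one element, i.e. there exists a non-constant meromorphic function $\phi$ on $\mathbb{C}$ with $\phi\in\mathcal{Z}_{c_0}(c_0)\cap\mathcal{P}(c_0)$.
   Context: For $c\in\mathbb{C}$ let $f_c(z)=z^2+c$, and let $f_c^n$ denote the $n$-th iterate. The Mandelbrot set $\mathbb{M}$ is the set of $c\in\mathbb{C}$ such that $(f_c^n(c))_{n\in\mathbb{N}}$ is bounded. A parameter $c_0\in\mathbb{M}$ is a Misiurewicz parameter if the forward orbit of $c_0$ under $f_{c_0}$ eventually lands on a repelling periodic point; that is, there exist (minimal) $l\ge1$ and $p\ge1$ such that $a_0:=f_{c_0}^l(c_0)$ satisfies $a_0=f_{c_0}^p(a_0)$ and $|(f_{c_0}^p)'(a_0)|>1$. $\mathrm{Aff}$ denotes the set of non-constant complex affine maps $w\mapsto aw+b$ ($a\in\mathbb{C}\setminus\{0\}$, $b\in\mathbb{C}$). For a family $\mathcal{F}$ of entire functions on $\mathbb{C}$ and $z_0\in\mathbb{C}$, $\mathcal{Z}(\mathcal{F},z_0)$ (the Zalcman functions of $\mathcal{F}$ at $z_0$) is the set of all non-constant meromorphic functions $\phi$ on $\mathbb{C}$ for which there exist $A_k\in\mathrm{Aff}$ and $F_k\in\mathcal{F}$ ($k\in\mathbb{N}$) such that $A_k$ converges to the constant function $z_0$ and $F_k\circ A_k$ converges to $\phi$, both uniformly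 on compact subsets of $\mathbb{C}$ in the spherical metric. Define $\mathcal{Z}_c(z_0):=\mathcal{Z}(\{z\mapsto f_c^n(z)\}_{n\ge0},z_0)$ and $\mathcal{P}(c_0):=\mathcal{Z}(\{c\mapsto f_c^n(c)\}_{n\ge0},c_0)$. *)

theory Defs
  imports "HOL-Complex_Analysis.Complex_Analysis"
begin

definition quad :: "complex \<Rightarrow> complex \<Rightarrow> complex" where
  "quad c z = z\<^sup>2 + c"

definition mandelbrot :: "complex set" where
  "mandelbrot = {c. bounded (range (\<lambda>n. (quad c ^^ n) c))}"

definition repelling_periodic :: "(complex \<Rightarrow> complex) \<Rightarrow> complex \<Rightarrow> bool" where
  "repelling_periodic f a \<longleftrightarrow> (\<exists>p\<ge>1. (f ^^ p) a = a \<and> norm (deriv (f ^^ p) a) > 1)"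

text \<open>
  Minimality of the preperiod \<open>l\<close> and of the period \<open>p\<close> only serves to make these numbers
  unique: a point that is repelling with respect to some period is also repelling with respect
  to the least one, so the existence statement is unaffected.
\<close>

definition misiurewicz :: "complex \<Rightarrow> bool" where
  "misiurewicz c0 \<longleftrightarrow>
     c0 \<in> mandelbrot \<and> (\<exists>l\<ge>1. repelling_periodic (quad c0) ((quad c0 ^^ l) c0))"

definition Aff :: "(complex \<Rightarrow> complex) set" where
  "Aff = {(\<lambda>w. a * w + b) | a b. a \<noteq> 0}"

text \<open>
  The Riemann sphere is \<^typ>\<open>complex option\<close> with \<^const>\<open>None\<close> as the point at infinity. It is
  identified with the unit sphere in \<^typ>\<open>complex \<times> real\<close> by inverse stereographic projection;
  the spherical metric is the great-circle distance there, i.e. the metric with length element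
  \<open>2 |dz| / (1 + |z|\<^sup>2)\<close>.
\<close>

definition stereo :: "complex option \<Rightarrow> complex \<times> real" where
  "stereo p = (case p of
       None \<Rightarrow> (0, 1)
     | Some z \<Rightarrow> ((2 / (1 + (norm z)\<^sup>2)) *\<^sub>R z, ((norm z)\<^sup>2 - 1) / ((norm z)\<^sup>2 + 1)))"

definition spherical_dist :: "complex option \<Rightarrow> complex option \<Rightarrow> real" where
  "spherical_dist p q = arccos (stereo p \<bullet> stereo q)"

text \<open>
  Meromorphic functions on the plane are represented by the total functions satisfying
  \<open>f nicely_meromorphic_on UNIV\<close>: removable singularities are filled in and the value at a
  pole is the dummy \<open>0\<close>, so that the representation is unique. The sphere-valued function that
  is meant sends the poles to infinity.
\<close>

definition to_sphere :: "(complex \<Rightarrow> complex) \<Rightarrow> complex \<Rightarrow> complex option" where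
  "to_sphere f z = (if is_pole f z then None else Some (f z))"

definition spherically_converges ::
    "(nat \<Rightarrow> complex \<Rightarrow> complex) \<Rightarrow> (complex \<Rightarrow> complex) \<Rightarrow> bool" where
  "spherically_converges G g \<longleftrightarrow>
     (\<forall>K. compact K \<longrightarrow> (\<forall>e>0. \<forall>\<^sub>F k in sequentially. \<forall>z\<in>K.
        spherical_dist (to_sphere (G k) z) (to_sphere g z) < e))"

definition zalcman :: "(complex \<Rightarrow> complex) set \<Rightarrow> complex \<Rightarrow> (complex \<Rightarrow> complex) set" where
  "zalcman \<F> z0 = {\<phi>. \<phi> nicely_meromorphic_on UNIV \<and> \<not> \<phi> constant_on UNIV \<and>
     (\<exists>A F. (\<forall>k. A k \<in> Aff) \<and> (\<forall>k. F k \<in> \<F>) \<and>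
        spherically_converges A (\<lambda>_. z0) \<and>
        spherically_converges (\<lambda>k. F k \<circ> A k) \<phi>)}"

definition zalcman_dynamical :: "complex \<Rightarrow> complex \<Rightarrow> (complex \<Rightarrow> complex) set" where
  "zalcman_dynamical c z0 = zalcman (range (\<lambda>n z. (quad c ^^ n) z)) z0"

definition zalcman_parameter :: "complex \<Rightarrow> (complex \<Rightarrow> complex) set" where
  "zalcman_parameter c0 = zalcman (range (\<lambda>n c. (quad c ^^ n) c)) c0"

end

theory Submission
  imports Defs "Jordan_Normal_Form.Char_Poly"
begin

text \<open>
  Write \<open>f\<^bsub>c\<^esub>\<close> for \<^term>\<open>quad c\<close>. After \<open>l\<close> steps the orbit of \<open>c0\<close> reaches a repelling fixed point
  \<open>a\<close> of \<open>f\<^bsub>c0\<^esub>\<^sup>p\<close> with multiplier \<open>\<rho>\<close>. The common Zalcman function is the Poincare function at \<open>a\<close>: a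
  limit \<open>\<phi>\<close> of \<open>h\<^sub>n(w) = f\<^bsub>c0\<^esub>\<^bsup>pn\<^esup>(a + w / \<rho>\<^sup>n)\<close>. Both families give functions asymptotic to \<open>h\<^sub>n\<close> when
  they are rescaled affinely at \<open>c0\<close>.

  Dynamical side: put \<open>\<beta> = (f\<^bsub>c0\<^esub>\<^sup>l)'(c0)\<close>, which is nonzero because the orbit of \<open>c0\<close>
  never meets the critical point \<open>0\<close>: otherwise \<open>0\<close> would be periodic, and the cycle on which the orbit
  ends would be superattracting. Then \<open>f\<^bsub>c0\<^esub>\<^sup>l(c0 + w / (\<beta> \<rho>\<^sup>n))\<close> agrees with
  \<open>a + w / \<rho>\<^sup>n\<close> up to an error of order \<open>|\<rho>|\<^sup>-\<^sup>2\<^sup>n\<close>.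

  Parameter side: for \<open>c = c0 + u\<close> the repelling point moves to \<open>a - \<sigma> u\<close> to first order, and the point
  \<open>f\<^bsub>c\<^esub>\<^sup>l(c)\<close> moves to \<open>a + E u\<close>, where \<open>E\<close> is its derivative in \<open>c\<close>. What the
  iteration magnifies is the difference \<open>\<kappa> u\<close> with \<open>\<kappa> = E + \<sigma>\<close>, so \<open>u = w / (\<kappa> \<rho>\<^sup>n)\<close> is the right scale, provided that \<open>\<kappa> \<noteq> 0\<close>. The lemma
  \<open>rescaled_iterates_close\<close> shows that \<open>f\<^bsub>c\<^esub>\<^bsup>pn\<^esup>\<close>, started at such a point, ends close to \<open>h\<^sub>n(w)\<close>: the
  total distortion along the orbit is summable, since the distance from \<open>a\<close> grows geometrically.

  That \<open>\<kappa> \<noteq> 0\<close> is the transversality of the Misiurewicz parameter (lemma \<open>transversality\<close>). Its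
  proof is arithmetic: \<open>c0\<close> is an algebraic integer, and if \<open>\<kappa>\<close> vanished, then \<open>2\<close> would be
  invertible in \<open>\<int>[c0]\<close>.

  Montel's theorem applies to \<open>(h\<^sub>n)\<close> and gives convergence along a subsequence, which is all that a
  Zalcman function requires. The limit is not constant because \<open>h\<^sub>n'(0) = 1\<close> for all \<open>n\<close>.
\<close>

section \<open>Derivatives of the iterates\<close>

primrec space_deriv :: "complex \<Rightarrow> complex \<Rightarrow> nat \<Rightarrow> complex" where
  "space_deriv c z 0 = 1"
| "space_deriv c z (Suc n) = 2 * (quad c ^^ n) z * space_deriv c z n"

text \<open>
  The derivative of \<open>c \<mapsto> f\<^bsub>c\<^esub>\<^sup>n(z)\<close> with the starting point \<open>z\<close> held fixed. At \<open>z = 0\<close> it is, up to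
  a shift of the index, the derivative of \<open>c \<mapsto> f\<^bsub>c\<^esub>\<^sup>n(c)\<close>, because \<open>f\<^bsub>c\<^esub>(0) = c\<close>.
\<close>

primrec param_deriv :: "complex \<Rightarrow> complex \<Rightarrow> nat \<Rightarrow> complex" where
  "param_deriv c z 0 = 0"
| "param_deriv c z (Suc n) = 2 * (quad c ^^ n) z * param_deriv c z n + 1"

lemma iterate_Suc: "(quad c ^^ Suc n) z = ((quad c ^^ n) z)\<^sup>2 + c"
  by (simp add: quad_def)

lemma param_deriv_add:
  "param_deriv c z (m + n) = space_deriv c ((quad c ^^ m) z) n * param_deriv c z m + param_deriv c ((quad c ^^ m) z) n"
proof (induction n)
  case (Suc n)
  have "(quad c ^^ n) ((quad c ^^ m) z) = (quad c ^^ (m + n)) z"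
    by (metis add.commute comp_apply funpow_add)
  with Suc show ?case by (simp add: algebra_simps)
qed simp

lemma has_field_derivative_iterate:
  "((quad c ^^ n) has_field_derivative space_deriv c z n) (at z)"
proof (induction n)
  case (Suc n)
  show ?case
    using DERIV_add[OF DERIV_power[OF Suc, of 2] DERIV_const[of c]]
    by (simp add: quad_def[abs_def] comp_def mult_ac)
qed simp

lemma space_deriv_nonzero_iff: "space_deriv c z n \<noteq> 0 \<longleftrightarrow> (\<forall>i<n. (quad c ^^ i) z \<noteq> 0)"
  by (induction n) (auto simp: less_Suc_eq)

lemma norm_le_of_linear_approx:
  fixes D h u P Q :: complex and C d :: real
  assumes "norm (D - P * h - Q * u) \<le> C * d * (norm h + norm u)" "d \<le> 3" "C \<ge> 0"
  shows "norm D \<le> (norm P + norm Q + 3 * C) * (norm h + norm u)"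
proof -
  have "norm D \<le> norm (D - P * h - Q * u) + norm (P * h) + norm (Q * u)"
    by norm
  also have "\<dots> \<le> C * d * (norm h + norm u) + norm P * norm h + norm Q * norm u"
    using assms(1) by (simp add: norm_mult)
  also have "\<dots> \<le> C * 3 * (norm h + norm u) + norm P * (norm h + norm u) + norm Q * (norm h + norm u)"
    using assms(2,3) by (intro add_mono mult_right_mono mult_left_mono) auto
  also have "\<dots> = (norm P + norm Q + 3 * C) * (norm h + norm u)" by (simp add: algebra_simps)
  finally show ?thesis .
qed

text \<open>
  The joint first order expansion of \<open>f\<^bsub>c\<^esub>\<^sup>n(x)\<close> in \<open>(c, x)\<close> at \<open>(c0, z)\<close>. The remainder is stated for
  the difference of two orbits: it is small relative to the difference of the initial data, not just
  quadratic in the distance from \<open>(c0, z)\<close>, and so errors can be compared over a number of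
  iterations that grows without bound. Taking \<open>y = z\<close> and \<open>c = c0\<close> gives the usual expansions.
\<close>

lemma iterate_expansion:
  fixes c0 z :: complex
  shows "\<exists>C\<ge>0. \<forall>c x y. norm (c - c0) \<le> 1 \<longrightarrow> norm (x - z) \<le> 1 \<longrightarrow> norm (y - z) \<le> 1 \<longrightarrow>
    norm ((quad c ^^ n) x - (quad c0 ^^ n) y - space_deriv c0 z n * (x - y) - param_deriv c0 z n * (c - c0))
      \<le> C * (norm (c - c0) + norm (x - z) + norm (y - z)) * (norm (x - y) + norm (c - c0))"
proof (induction n)
  case 0
  show ?case by (intro exI[of _ 0]) auto
next
  case (Suc n)
  define P where "P = space_deriv c0 z n"
  define Q where "Q = param_deriv c0 z n"
  define zn where "zn = (quad c0 ^^ n) z"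
  obtain C where C: "C \<ge> 0" and est: "\<And>c x y. norm (c - c0) \<le> 1 \<Longrightarrow> norm (x - z) \<le> 1 \<Longrightarrow> norm (y - z) \<le> 1 \<Longrightarrow>
    norm ((quad c ^^ n) x - (quad c0 ^^ n) y - P * (x - y) - Q * (c - c0))
      \<le> C * (norm (c - c0) + norm (x - z) + norm (y - z)) * (norm (x - y) + norm (c - c0))"
    using Suc unfolding P_def Q_def by blast
  define L where "L = norm P + norm Q + 3 * C"
  have L: "L \<ge> 0" using C by (simp add: L_def)
  have lip: "norm ((quad c ^^ n) x - (quad c0 ^^ n) y) \<le> L * (norm (x - y) + norm (c - c0))"
    if h: "norm (c - c0) \<le> 1" "norm (x - z) \<le> 1" "norm (y - z) \<le> 1" for c x y
    using norm_le_of_linear_approx[OF est[OF h]] h C by (simp add: L_def)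
  show ?case
  proof (intro exI[of _ "2 * norm zn * C + 2 * L * L"] conjI allI impI)
    show "2 * norm zn * C + 2 * L * L \<ge> 0" using C L by simp
  next
    fix c x y assume h: "norm (c - c0) \<le> 1" "norm (x - z) \<le> 1" "norm (y - z) \<le> 1"
    define X where "X = (quad c ^^ n) x"
    define Y where "Y = (quad c0 ^^ n) y"
    define m where "m = norm (x - y) + norm (c - c0)"
    define d where "d = norm (c - c0) + norm (x - z) + norm (y - z)"
    have m: "m \<ge> 0" and d: "d \<ge> 0" by (simp_all add: m_def d_def)
    have 1: "norm (X - Y) \<le> L * m"
      using lip[OF h] by (simp add: X_def Y_def m_def)
    have 2: "norm (X - zn) \<le> L * d"
    proof -
      have "norm (X - zn) \<le> L * (norm (x - z) + norm (c - c0))"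
        using lip[of c x z] h by (simp add: X_def zn_def)
      also have "\<dots> \<le> L * d" using L by (intro mult_left_mono) (auto simp: d_def)
      finally show ?thesis .
    qed
    have 3: "norm (Y - zn) \<le> L * d"
    proof -
      have "norm (Y - zn) \<le> L * (norm (y - z))"
        using lip[of c0 y z] h by (simp add: Y_def zn_def)
      also have "\<dots> \<le> L * d" using L by (intro mult_left_mono) (auto simp: d_def)
      finally show ?thesis .
    qed
    \<comment> \<open>Uses \<open>X\<^sup>2 - Y\<^sup>2 = 2 z\<^sub>n (X - Y) + (X - Y) ((X - z\<^sub>n) + (Y - z\<^sub>n))\<close>.\<close>
    have "(quad c ^^ Suc n) x - (quad c0 ^^ Suc n) y - space_deriv c0 z (Suc n) * (x - y) - param_deriv c0 z (Suc n) * (c - c0)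
      = 2 * zn * (X - Y - P * (x - y) - Q * (c - c0)) + (X - Y) * ((X - zn) + (Y - zn))"
      by (simp add: quad_def X_def Y_def zn_def P_def Q_def algebra_simps power2_eq_square)
    also have "norm \<dots> \<le> 2 * norm zn * norm (X - Y - P * (x - y) - Q * (c - c0)) + norm (X - Y) * (norm (X - zn) + norm (Y - zn))"
      using mult_left_mono[OF norm_triangle_ineq[of "X - zn" "Y - zn"] norm_ge_zero[of "X - Y"]]
      by (intro norm_triangle_le) (simp only: norm_mult norm_numeral add_left_mono)
    also have "\<dots> \<le> 2 * norm zn * (C * d * m) + (L * m) * (L * d + L * d)"
      using est[OF h] 1 2 3 m L d
      by (intro add_mono mult_mono) (auto simp: X_def Y_def m_def d_def)
    also have "\<dots> = (2 * norm zn * C + 2 * L * L) * d * m" by (simp add: algebra_simps)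
    finally show "norm ((quad c ^^ Suc n) x - (quad c0 ^^ Suc n) y - space_deriv c0 z (Suc n) * (x - y) - param_deriv c0 z (Suc n) * (c - c0))
      \<le> (2 * norm zn * C + 2 * L * L) * (norm (c - c0) + norm (x - z) + norm (y - z)) * (norm (x - y) + norm (c - c0))"
      by (simp add: m_def d_def)
  qed
qed

lemma iterate_lipschitz:
  fixes c0 z :: complex
  shows "\<exists>L\<ge>0. \<forall>c x y. norm (c - c0) \<le> 1 \<longrightarrow> norm (x - z) \<le> 1 \<longrightarrow> norm (y - z) \<le> 1 \<longrightarrow>
    norm ((quad c ^^ n) x - (quad c0 ^^ n) y) \<le> L * (norm (x - y) + norm (c - c0))"
proof -
  obtain C where C: "C \<ge> 0" and est: "\<And>c x y. norm (c - c0) \<le> 1 \<Longrightarrow> norm (x - z) \<le> 1 \<Longrightarrow> norm (y - z) \<le> 1 \<Longrightarrow>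
    norm ((quad c ^^ n) x - (quad c0 ^^ n) y - space_deriv c0 z n * (x - y) - param_deriv c0 z n * (c - c0))
      \<le> C * (norm (c - c0) + norm (x - z) + norm (y - z)) * (norm (x - y) + norm (c - c0))"
    using iterate_expansion[of c0 z n] by blast
  show ?thesis
    using norm_le_of_linear_approx[OF est] C
    by (intro exI[of _ "norm (space_deriv c0 z n) + norm (param_deriv c0 z n) + 3 * C"]) auto
qed

section \<open>Integrality and transversality\<close>

text \<open>
  A monic relation for \<open>x\<close> rewrites its \<open>(d + 1)\<close>-st power in lower ones, so \<open>\<int>[x]\<close> is generated as an
  additive group by finitely many powers of \<open>x\<close>.
\<close>

lemma int_poly_value_in_power_span:
  fixes x :: complex
  assumes P: "lead_coeff P = 1" "degree P = Suc d" "poly (of_int_poly P) x = 0"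
  shows "\<exists>m :: nat \<Rightarrow> int. poly (of_int_poly q) x = (\<Sum>i<Suc d. of_int (m i) * x ^ i)"
proof (induction q)
  case 0
  show ?case by (intro exI[of _ "\<lambda>_. 0"]) simp
next
  case (pCons a q)
  then obtain m :: "nat \<Rightarrow> int" where m: "poly (of_int_poly q) x = (\<Sum>i<Suc d. of_int (m i) * x ^ i)"
    by blast
  have "0 = (\<Sum>i\<le>Suc d. of_int (coeff P i) * x ^ i)"
    using P by (simp add: poly_altdef)
  also have "\<dots> = (\<Sum>i<Suc d. of_int (coeff P i) * x ^ i) + x ^ Suc d"
    using P by (simp add: lessThan_Suc_atMost [symmetric])
  finally have top: "x ^ Suc d = - (\<Sum>i<Suc d. of_int (coeff P i) * x ^ i)"
    by (metis add_eq_0_iff)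
  define m' where "m' = (\<lambda>i. (if i = 0 then a else m (i - 1)) - m d * coeff P i)"
  have "poly (of_int_poly (pCons a q)) x = of_int a + x * (\<Sum>i<Suc d. of_int (m i) * x ^ i)"
    using m by (simp add: of_int_hom.map_poly_pCons_hom)
  also have "\<dots> = of_int a + (\<Sum>i<d. of_int (m i) * x ^ Suc i) + of_int (m d) * x ^ Suc d"
    by (simp add: sum_distrib_left algebra_simps)
  also have "of_int a + (\<Sum>i<d. of_int (m i) * x ^ Suc i) =
      (\<Sum>i<Suc d. of_int (if i = 0 then a else m (i - 1)) * x ^ i)"
    by (subst sum.lessThan_Suc_shift) simp
  also have "\<dots> + of_int (m d) * x ^ Suc d = (\<Sum>i<Suc d. of_int (m' i) * x ^ i)"
    unfolding top m'_def
    by (simp add: sum_subtractf sum_distrib_left left_diff_distrib mult.assoc del: sum.lessThan_Suc)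
  finally show ?case by blast
qed

text \<open>
  Multiplication by \<open>t \<in> \<int>[x]\<close> acts on the powers of \<open>x\<close> by an integer matrix, with the vector of these
  powers as an eigenvector for \<open>t\<close>. Hence \<open>t\<close> is a root of a monic integer polynomial, namely the
  characteristic polynomial of that matrix.
\<close>

lemma algebraic_int_poly_of_int:
  fixes x :: complex
  assumes "algebraic_int x"
  shows "algebraic_int (poly (of_int_poly q) x)"
proof -
  obtain P :: "int poly" where P: "lead_coeff P = 1" "poly (of_int_poly P) x = 0"
    using assms unfolding algebraic_int_altdef_ipoly by blast
  have "degree P \<noteq> 0"
  proof
    assume "degree P = 0"
    then obtain a where "P = [:a:]" by (meson degree_eq_zeroE)
    with P show False by simp
  qed
  then obtain d where d: "degree P = Suc d" by (meson not0_implies_Suc)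
  define t where "t = poly (of_int_poly q) x"
  have "\<exists>m :: nat \<Rightarrow> int. t * x ^ i = (\<Sum>j<Suc d. of_int (m j) * x ^ j)" for i
    using int_poly_value_in_power_span[OF P(1) d P(2), of "q * monom 1 i"]
    by (simp add: t_def of_int_poly_hom.hom_mult poly_monom of_int_hom.map_poly_hom_monom)
  then obtain M :: "nat \<Rightarrow> nat \<Rightarrow> int" where M: "\<And>i. t * x ^ i = (\<Sum>j<Suc d. of_int (M i j) * x ^ j)"
    by metis
  define A where "A = mat (Suc d) (Suc d) (\<lambda>(i, j). M i j)"
  define Ac :: "complex mat" where "Ac = map_mat of_int A"
  define v where "v = vec (Suc d) (\<lambda>i. x ^ i)"
  have A: "A \<in> carrier_mat (Suc d) (Suc d)" and Ac: "Ac \<in> carrier_mat (Suc d) (Suc d)"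
    by (simp_all add: A_def Ac_def)
  have "Ac *\<^sub>v v = t \<cdot>\<^sub>v v"
    by (rule eq_vecI) (auto simp: Ac_def A_def v_def scalar_prod_def M lessThan_atLeast0 simp del: sum.op_ivl_Suc intro!: sum.cong)
  moreover have "v \<noteq> 0\<^sub>v (Suc d)"
  proof
    assume "v = 0\<^sub>v (Suc d)"
    then have "v $ 0 = 0" by simp
    then show False by (simp add: v_def)
  qed
  ultimately have "eigenvalue Ac t"
    unfolding eigenvalue_def eigenvector_def using Ac by (intro exI[of _ v]) (auto simp: v_def)
  then have "poly (char_poly Ac) t = 0" using eigenvalue_root_char_poly[OF Ac] by simp
  moreover have "char_poly Ac = of_int_poly (char_poly A)"
    unfolding Ac_def using of_int_hom.char_poly_hom[OF A] by simp
  ultimately show ?thesis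
    using degree_monic_char_poly[OF A] unfolding algebraic_int_altdef_ipoly t_def[symmetric] by auto
qed

text \<open>
  This is the ring \<open>\<int>[x]\<close>, realised inside the complex numbers.
\<close>

definition int_poly_values :: "complex \<Rightarrow> complex set" where
  "int_poly_values x = range (\<lambda>q. poly (of_int_poly q) x)"

lemma int_poly_values_closed:
  shows "0 \<in> int_poly_values x" "1 \<in> int_poly_values x" "x \<in> int_poly_values x"
    and "a \<in> int_poly_values x \<Longrightarrow> b \<in> int_poly_values x \<Longrightarrow> a + b \<in> int_poly_values x"
    and "a \<in> int_poly_values x \<Longrightarrow> b \<in> int_poly_values x \<Longrightarrow> a - b \<in> int_poly_values x"
    and "a \<in> int_poly_values x \<Longrightarrow> b \<in> int_poly_values x \<Longrightarrow> a * b \<in> int_poly_values x"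
proof -
  have I: "poly (of_int_poly q) x = y \<Longrightarrow> y \<in> int_poly_values x" for q y
    by (auto simp: int_poly_values_def)
  show "0 \<in> int_poly_values x" by (rule I[of 0]) simp
  show "1 \<in> int_poly_values x" by (rule I[of 1]) simp
  show "x \<in> int_poly_values x" by (rule I[of "[:0, 1:]"]) simp
  assume "a \<in> int_poly_values x" "b \<in> int_poly_values x"
  then obtain q r where q: "a = poly (of_int_poly q) x" and r: "b = poly (of_int_poly r) x"
    by (auto simp: int_poly_values_def)
  show "a + b \<in> int_poly_values x" by (rule I[of "q + r"]) (simp add: q r of_int_poly_hom.hom_add)
  show "a - b \<in> int_poly_values x" by (rule I[of "q - r"]) (simp add: q r of_int_poly_hom.hom_minus)
  show "a * b \<in> int_poly_values x" by (rule I[of "q * r"]) (simp add: q r of_int_poly_hom.hom_mult)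
qed

lemma two_not_invertible:
  assumes "algebraic_int x" "t \<in> int_poly_values x"
  shows "2 * t \<noteq> 1"
proof
  assume "2 * t = 1"
  then have "t = 1 / 2" by (simp add: field_simps)
  moreover have "(1 / 2 :: complex) \<in> \<rat>" by (intro Rats_divide) auto
  ultimately have "t \<in> \<rat>" by (simp only:)
  have "algebraic_int t" using assms algebraic_int_poly_of_int by (auto simp: int_poly_values_def)
  then have "t \<in> \<int>" using \<open>t \<in> \<rat>\<close> by (rule rational_algebraic_int_is_int)
  then obtain k where "t = of_int k" by (rule Ints_cases)
  with \<open>2 * t = 1\<close> have "of_int (2 * k) = (of_int 1 :: complex)" by simp
  then have "2 * k = 1" by (simp only: of_int_eq_iff)
  then show False by presburger
qed

lemma critical_orbit_in_int_poly_values: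
  "(quad c ^^ n) 0 \<in> int_poly_values c" "param_deriv c 0 n \<in> int_poly_values c"
proof -
  show X: "(quad c ^^ n) 0 \<in> int_poly_values c" for n
    by (induction n) (auto simp: quad_def power2_eq_square intro!: int_poly_values_closed)
  show "param_deriv c 0 n \<in> int_poly_values c"
  proof (induction n)
    case (Suc n)
    have "param_deriv c 0 (Suc n) = (quad c ^^ n) 0 * param_deriv c 0 n + (quad c ^^ n) 0 * param_deriv c 0 n + 1" by simp
    then show ?case using X Suc int_poly_values_closed by metis
  qed (auto intro: int_poly_values_closed)
qed

text \<open>
  The recursion gives \<open>param_deriv c 0 n \<equiv> 1\<close> modulo \<open>2\<close> for \<open>n \<ge> 1\<close>. For \<open>n = 0\<close> this is false, but
  after multiplication by the orbit point the congruence holds for all \<open>n\<close>, because the orbit starts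
  at \<open>0\<close>. This avoids a separate case for preperiod one.
\<close>

lemma param_deriv_critical_odd:
  "\<exists>k \<in> int_poly_values c. (quad c ^^ n) 0 * param_deriv c 0 n = (quad c ^^ n) 0 + 2 * k"
proof (cases n)
  case 0
  then show ?thesis by (intro bexI[of _ 0]) (auto intro: int_poly_values_closed)
next
  case (Suc m)
  have "(quad c ^^ n) 0 * param_deriv c 0 n = (quad c ^^ n) 0 + 2 * ((quad c ^^ n) 0 * ((quad c ^^ m) 0 * param_deriv c 0 m))"
    unfolding Suc param_deriv.simps by (simp add: algebra_simps)
  moreover have "(quad c ^^ n) 0 * ((quad c ^^ m) 0 * param_deriv c 0 m) \<in> int_poly_values c"
    by (intro int_poly_values_closed critical_orbit_in_int_poly_values)
  ultimately show ?thesis by blast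
qed

text \<open>
  The arithmetic core of transversality. Let \<open>x\<close> and \<open>y\<close> be the predecessors of the two antipodal
  points. If the sum of the derivatives were zero, then \<open>1 + x + y\<close> would vanish modulo \<open>2\<close>. But
  antipodality says \<open>x\<^sup>2 + y\<^sup>2 = - 2 c\<close>, so \<open>(x + y)\<^sup>2\<close> vanishes modulo \<open>2\<close>, and \<open>(x + y)\<^sup>2\<close> is also
  congruent to \<open>1\<close>. Then \<open>2\<close> divides \<open>1\<close> in \<open>\<int>[c]\<close>.
\<close>

lemma param_deriv_antipodal:
  assumes c: "algebraic_int c" and anti: "(quad c ^^ Suc m) 0 = - (quad c ^^ Suc n) 0"
  shows "param_deriv c 0 (Suc m) + param_deriv c 0 (Suc n) \<noteq> 0"
proof
  assume "param_deriv c 0 (Suc m) + param_deriv c 0 (Suc n) = 0"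
  define x y where "x = (quad c ^^ m) 0" and "y = (quad c ^^ n) 0"
  obtain j k where j: "j \<in> int_poly_values c" "x * param_deriv c 0 m = x + 2 * j"
    and k: "k \<in> int_poly_values c" "y * param_deriv c 0 n = y + 2 * k"
    using param_deriv_critical_odd unfolding x_def y_def by metis
  have "2 * (1 + x * param_deriv c 0 m + y * param_deriv c 0 n) = 0"
    using \<open>param_deriv c 0 (Suc m) + param_deriv c 0 (Suc n) = 0\<close> by (simp add: x_def y_def algebra_simps)
  then have sum: "1 + x * param_deriv c 0 m + y * param_deriv c 0 n = 0" by (simp only: mult_eq_0_iff) simp
  define l where "l = j + k"
  have xy: "x + y = - (1 + 2 * l)"
  proof -
    have "x + y = (1 + (x + 2 * j) + (y + 2 * k)) - (1 + 2 * l)"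
      by (simp add: l_def algebra_simps)
    then show ?thesis using sum by (simp only: j(2) k(2)) simp
  qed
  have "x\<^sup>2 + c = - (y\<^sup>2 + c)"
    using anti by (simp only: iterate_Suc x_def y_def)
  then have sq: "x\<^sup>2 + y\<^sup>2 = - 2 * c"
    by (simp add: add_eq_0_iff eq_neg_iff_add_eq_0)
  have "(1 + 2 * l)\<^sup>2 = (x + y)\<^sup>2" unfolding xy by (simp only: power2_minus)
  also have "\<dots> = x\<^sup>2 + y\<^sup>2 + 2 * (x * y)" by (simp add: power2_eq_square algebra_simps)
  finally have "2 * (x * y - c - (l + l) - (l * l + l * l)) = 1"
    unfolding sq by (simp add: power2_eq_square algebra_simps)
  moreover have "x * y - c - (l + l) - (l * l + l * l) \<in> int_poly_values c"
    unfolding l_def x_def y_def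
    by (intro int_poly_values_closed critical_orbit_in_int_poly_values j(1) k(1))
  ultimately show False using two_not_invertible[OF c] by blast
qed

primrec critical_poly :: "nat \<Rightarrow> int poly" where
  "critical_poly 0 = 0"
| "critical_poly (Suc n) = critical_poly n ^ 2 + [:0, 1:]"

lemma poly_critical_poly: "poly (of_int_poly (critical_poly n)) c = (quad c ^^ n) 0"
  by (induction n) (simp_all add: quad_def of_int_poly_hom.hom_add of_int_poly_hom.hom_power)

lemma critical_poly_monic: "degree (critical_poly (Suc n)) = 2 ^ n \<and> lead_coeff (critical_poly (Suc n)) = 1"
proof (induction n)
  case (Suc n)
  define P where "P = critical_poly (Suc n)"
  have P: "degree P = 2 ^ n" "lead_coeff P = 1"
    using Suc unfolding P_def by blast+
  have Q: "critical_poly (Suc (Suc n)) = [:0, 1:] + P ^ 2"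
    by (simp only: P_def critical_poly.simps(2)[of "Suc n"] add.commute)
  have "P \<noteq> 0" using P by auto
  then have d: "degree (P ^ 2) = 2 ^ Suc n" using P by (simp add: degree_power_eq)
  have small: "degree [:0, 1 :: int:] < degree (P ^ 2)" unfolding d
    using one_less_power[of "2 :: nat" "Suc n"] by simp
  have "lead_coeff (P ^ 2) = 1" by (simp only: lead_coeff_power P(2) power_one)
  then have "lead_coeff ([:0, 1:] + P ^ 2) = 1" by (simp only: lead_coeff_add_le[OF small])
  moreover have "degree ([:0, 1:] + P ^ 2) = 2 ^ Suc n" by (simp only: degree_add_eq_right[OF small] d)
  ultimately show ?case unfolding Q by blast
qed simp

text \<open>
  The equation that makes the critical orbit preperiodic is monic in \<open>c\<close>, since the later of the two
  iterates has the larger degree.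
\<close>

lemma algebraic_int_preperiodic:
  assumes "p \<ge> 1" "(quad c ^^ (Suc l + p)) 0 = (quad c ^^ Suc l) 0"
  shows "algebraic_int c"
proof -
  define P where "P = critical_poly (Suc (l + p))"
  define Q where "Q = critical_poly (Suc l)"
  have "degree Q < degree P" using assms(1) critical_poly_monic by (simp add: P_def Q_def del: critical_poly.simps)
  moreover have "lead_coeff P = 1" using critical_poly_monic P_def by blast
  ultimately have "lead_coeff (P - Q) = 1"
    using lead_coeff_add_le[of "- Q" P] by simp
  moreover have "poly (of_int_poly (P - Q)) c = 0"
    using assms(2) by (simp add: P_def Q_def poly_critical_poly of_int_poly_hom.hom_minus del: critical_poly.simps funpow.simps)
  ultimately show ?thesis unfolding algebraic_int_altdef_ipoly by blast
qed

text \<open>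
  If \<open>i\<close> is least such that the points \<open>f\<^bsub>c\<^esub>\<^bsup>i+p\<^esup>(0)\<close> and \<open>f\<^bsub>c\<^esub>\<^sup>i(0)\<close> coincide, then their predecessors are
  antipodal, and \<open>param_deriv_antipodal\<close> separates the derivatives. From then on the difference of
  the derivatives is multiplied by twice the orbit point in each step, and the orbit avoids \<open>0\<close>.
\<close>

lemma transversality:
  assumes nz: "\<And>i. (quad c ^^ Suc i) 0 \<noteq> 0" and p: "p \<ge> 1"
    and per: "(quad c ^^ (Suc l + p)) 0 = (quad c ^^ Suc l) 0"
  shows "param_deriv c 0 (Suc l + p) \<noteq> param_deriv c 0 (Suc l)"
  using per
proof (induction l)
  case 0
  then have "((quad c ^^ p) 0)\<^sup>2 + c = c"
    by (simp only: add_Suc iterate_Suc) simp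
  then have "(quad c ^^ p) 0 = 0" by simp
  then show ?case using nz[of "p - 1"] p by simp
next
  case (Suc l)
  define x y where "x = (quad c ^^ (Suc l + p)) 0" and "y = (quad c ^^ Suc l) 0"
  define X Y where "X = param_deriv c 0 (Suc l + p)" and "Y = param_deriv c 0 (Suc l)"
  have d: "param_deriv c 0 (Suc (Suc l) + p) = 2 * x * X + 1" "param_deriv c 0 (Suc (Suc l)) = 2 * y * Y + 1"
    by (simp_all only: x_def y_def X_def Y_def add_Suc param_deriv.simps(2)[of c 0 "Suc _"])
  have x: "x \<noteq> 0" using nz[of "l + p"] unfolding x_def add_Suc .
  have "x\<^sup>2 = y\<^sup>2" using Suc.prems by (simp only: x_def y_def add_Suc iterate_Suc) simp
  then consider "x = y" | "x = - y" by (auto simp: power2_eq_iff)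
  then show ?case
  proof cases
    case 1
    then have "X \<noteq> Y" using Suc.IH unfolding x_def y_def X_def Y_def by blast
    then show ?thesis unfolding d 1[symmetric] using x by simp
  next
    case 2
    have "algebraic_int c" using algebraic_int_preperiodic[OF p Suc.prems] .
    moreover have "(quad c ^^ Suc (l + p)) 0 = - (quad c ^^ Suc l) 0"
      using 2 unfolding x_def y_def add_Suc .
    ultimately have "X + Y \<noteq> 0" unfolding X_def Y_def add_Suc by (rule param_deriv_antipodal)
    moreover have "y = - x" using 2 by simp
    moreover have "2 * x * X + 1 - (2 * (- x) * Y + 1) = 2 * x * (X + Y)"
      by (simp add: algebra_simps)
    ultimately show ?thesis unfolding d using x by force
  qed
qed

text \<open>
  If the critical orbit returned to \<open>0\<close>, it would do so infinitely often, so \<open>0\<close> would lie on the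
  cycle that the orbit eventually follows, and the multiplier of that cycle would be zero.
\<close>

lemma critical_orbit_nonzero:
  assumes per: "(quad c ^^ p) ((quad c ^^ Suc l) 0) = (quad c ^^ Suc l) 0"
    and p: "p \<ge> 1" and mult: "space_deriv c ((quad c ^^ Suc l) 0) p \<noteq> 0"
  shows "(quad c ^^ Suc i) 0 \<noteq> 0"
proof
  assume "(quad c ^^ Suc i) 0 = 0"
  then have "((quad c ^^ Suc i) ^^ Suc l) 0 = 0" by (induction l) auto
  then have z: "(quad c ^^ (Suc i * Suc l)) 0 = 0" by (simp only: funpow_mult)
  have "Suc i * Suc l = i * Suc l + Suc l" by simp
  then have "(quad c ^^ (i * Suc l)) ((quad c ^^ Suc l) 0) = 0"
    using z by (metis comp_apply funpow_add)
  then have "(quad c ^^ (i * Suc l mod p)) ((quad c ^^ Suc l) 0) = 0"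
    by (simp only: funpow_mod_eq[OF per])
  moreover have "i * Suc l mod p < p" using p by simp
  ultimately show False using mult space_deriv_nonzero_iff by blast
qed

section \<open>Discrete growth estimates\<close>

text \<open>
  Here \<open>z j\<close> is the distance of the orbit from the repelling point, and \<open>t\<close> will be \<open>r\<^sup>-\<^sup>n\<close>. The quadratic
  term does not spoil the growth rate \<open>r\<close>: relative to \<open>t r\<^sup>j\<close> it contributes a geometric series that is
  dominated by its last term, and that is small as long as \<open>t r\<^sup>N \<le> \<eta>\<close>. The threshold \<open>\<eta>\<close> depends
  only on the constants, which makes the bound uniform in the orbit and in \<open>N\<close>.
\<close>

lemma growth_bound:
  fixes r W C :: real
  assumes r: "r > 1" and W: "W > 0" and C: "C \<ge> 0"
  obtains \<eta> where "\<eta> > 0" "2 * W * \<eta> \<le> 1"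
    "\<And>z N t j. t > 0 \<Longrightarrow> z 0 \<le> W * t \<Longrightarrow> t * r ^ N \<le> \<eta> \<Longrightarrow>
      (\<And>j. j < N \<Longrightarrow> z j \<le> 1 \<Longrightarrow> z (Suc j) \<le> r * z j + C * (z j)\<^sup>2) \<Longrightarrow> (\<And>j. z j \<ge> 0) \<Longrightarrow>
      j \<le> N \<Longrightarrow> z j \<le> 2 * W * (t * r ^ j)"
proof -
  define K where "K = (4 * C * W\<^sup>2 + 1) / (r - 1)"
  have K: "K > 0" "K * (r - 1) \<ge> 4 * C * W\<^sup>2" using r C by (auto simp: K_def intro!: divide_pos_pos add_nonneg_pos)
  define \<eta> where "\<eta> = min (1 / (2 * W)) (W / K)"
  show thesis
  proof
    show e: "\<eta> > 0" using W K by (simp add: \<eta>_def)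
    have e1: "2 * W * \<eta> \<le> 1" and e2: "K * \<eta> \<le> W" using W K by (auto simp: \<eta>_def min_def field_simps)
    show "2 * W * \<eta> \<le> 1" by fact
    fix z :: "nat \<Rightarrow> real" and N t j
    assume t: "t > 0" and z0: "z 0 \<le> W * t" and tN: "t * r ^ N \<le> \<eta>"
      and step: "\<And>j. j < N \<Longrightarrow> z j \<le> 1 \<Longrightarrow> z (Suc j) \<le> r * z j + C * (z j)\<^sup>2"
      and nn: "\<And>j. z j \<ge> 0" and "j \<le> N"
    have small: "t * r ^ i \<le> \<eta>" "t * r ^ i > 0" if "i \<le> N" for i
    proof -
      have "r ^ i \<le> r ^ N" using r that by (intro power_increasing) auto
      then have "t * r ^ i \<le> t * r ^ N" using t by simp
      with tN show "t * r ^ i \<le> \<eta>" by linarith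
      show "t * r ^ i > 0" using t r by simp
    qed
    have Kt: "W + K * (t * r ^ i) \<le> 2 * W" if "i \<le> N" for i
      using mult_left_mono[OF small(1)[OF that], of K] e2 K by linarith
    \<comment> \<open>The additive correction makes the induction close; \<open>K\<close> is chosen so that \<open>K (r - 1)\<close> absorbs the quadratic term.\<close>
    have "z j \<le> (W + K * (t * r ^ j)) * (t * r ^ j)" using \<open>j \<le> N\<close>
    proof (induction j)
      case 0
      have "0 \<le> K * t * t" using K t by simp
      then show ?case using z0 by (simp add: algebra_simps)
    next
      case (Suc j)
      define s where "s = t * r ^ j"
      have s: "s > 0" "s \<le> \<eta>" using small[of j] Suc by (auto simp: s_def)
      have IH: "z j \<le> (W + K * s) * s" using Suc by (simp add: s_def)
      also have "\<dots> \<le> 2 * W * s" using Kt[of j] Suc s by (intro mult_right_mono) (auto simp: s_def)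
      finally have zs: "z j \<le> 2 * W * s" .
      also have "\<dots> \<le> 2 * W * \<eta>" using s W by simp
      finally have "z j \<le> 1" using e1 by linarith
      then have "z (Suc j) \<le> r * z j + C * (z j)\<^sup>2" using step Suc by simp
      also have "\<dots> \<le> r * ((W + K * s) * s) + C * (2 * W * s)\<^sup>2"
        using IH zs nn r C by (intro add_mono mult_left_mono power_mono) auto
      also have "\<dots> = r * W * s + r * K * s\<^sup>2 + 4 * C * W\<^sup>2 * s\<^sup>2" by (simp add: algebra_simps power2_eq_square)
      also have "\<dots> \<le> r * W * s + r * K * s\<^sup>2 + r * (K * (r - 1)) * s\<^sup>2"
      proof -
        have "4 * C * W\<^sup>2 \<le> K * (r - 1)" by (fact K)
        also have "\<dots> \<le> r * (K * (r - 1))" using r K(1) by (simp add: mult_le_cancel_right1 not_less)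
        finally show ?thesis by (intro add_left_mono mult_right_mono) auto
      qed
      also have "\<dots> = (W + K * (r * s)) * (r * s)" by (simp add: algebra_simps power2_eq_square)
      finally show ?case by (simp add: s_def algebra_simps)
    qed
    also have "\<dots> \<le> 2 * W * (t * r ^ j)"
      using Kt[of j] small[of j] \<open>j \<le> N\<close> by (intro mult_right_mono) auto
    finally show "z j \<le> 2 * W * (t * r ^ j)" .
  qed
qed

text \<open>
  Here \<open>e j\<close> is the distance between two orbits after correction for the motion of the repelling point,
  and \<open>t\<close> again plays the role of \<open>r\<^sup>-\<^sup>n\<close>. The factors \<open>1 + A t r\<^sup>j\<close> multiply up to a bounded constant,
  again by a geometric series, and the inhomogeneous terms add up to \<open>A j t\<^sup>2\<close> relative to \<open>r\<^sup>j\<close>. So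
  \<open>e N\<close> is at most of order \<open>n r\<^sup>-\<^sup>n\<close>. The hypothesis \<open>small\<close> keeps the orbits in the region where the
  recursive inequality is available.
\<close>

lemma difference_bound:
  fixes r A B t :: real
  assumes r: "r > 1" and A: "A \<ge> 0" and B: "B \<ge> 0" and t: "t > 0" and tN: "t * r ^ N \<le> 1"
    and e0: "e 0 \<le> B * t\<^sup>2"
    and small: "(B + A * N) * exp (A / (r - 1)) * t \<le> 1"
    and step: "\<And>j. j < N \<Longrightarrow> e j \<le> t * r ^ j \<Longrightarrow> e (Suc j) \<le> r * e j + A * (t * r ^ j) * (e j + t)"
    and j: "j \<le> N"
  shows "e j \<le> (B + A * j) * exp (A / (r - 1)) * t\<^sup>2 * r ^ j" "e j \<le> t * r ^ j"
proof -
  define Q where "Q = A / (r - 1)"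
  have Q: "Q \<ge> 0" "Q * r = A + Q" using r A by (auto simp: Q_def field_simps)
  have bound: "t * r ^ i \<le> 1" "t * r ^ i > 0" if "i \<le> N" for i
  proof -
    have "r ^ i \<le> r ^ N" using r that by (intro power_increasing) auto
    then have "t * r ^ i \<le> t * r ^ N" using t by simp
    with tN show "t * r ^ i \<le> 1" by linarith
    show "t * r ^ i > 0" using t r by simp
  qed
  have weak: "(B + A * i) * exp (Q * (t * r ^ i)) * t\<^sup>2 * r ^ i \<le> (B + A * i) * exp Q * t\<^sup>2 * r ^ i"
    if "i \<le> N" for i
    using bound[OF that] A B Q r t
    by (intro mult_right_mono mult_left_mono) (auto simp: mult_left_le)
  have weak2: "(B + A * i) * exp Q * t\<^sup>2 * r ^ i \<le> t * r ^ i" if "i \<le> N" for i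
  proof -
    have "(B + A * i) * exp Q * t \<le> (B + A * N) * exp Q * t"
      using that A B t by (intro mult_right_mono add_left_mono mult_left_mono) auto
    also have "\<dots> \<le> 1" using small by (simp add: Q_def)
    finally have "(B + A * i) * exp Q * t * (t * r ^ i) \<le> 1 * (t * r ^ i)"
      using bound[OF that] by (intro mult_right_mono) auto
    then show ?thesis by (simp add: power2_eq_square algebra_simps)
  qed
  \<comment> \<open>The exponential factor stands for the product of the \<open>1 + A t r\<^sup>i\<close> with \<open>i < j\<close>; \<open>Q\<close> satisfies \<open>Q r = A + Q\<close>.\<close>
  have main: "e j \<le> (B + A * j) * exp (Q * (t * r ^ j)) * t\<^sup>2 * r ^ j" using j
  proof (induction j)
    case 0
    have "B * t\<^sup>2 * 1 \<le> B * t\<^sup>2 * exp (Q * t)"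
      using B Q t by (intro mult_left_mono) auto
    then show ?case using e0 by (simp add: algebra_simps)
  next
    case (Suc j)
    define s where "s = t * r ^ j"
    have s: "s > 0" "s \<le> 1" using bound[of j] Suc by (auto simp: s_def)
    define G where "G = B + A * j"
    have G: "G \<ge> 0" using A B by (simp add: G_def)
    have IH: "e j \<le> G * exp (Q * s) * t * s"
      using Suc by (simp add: s_def G_def power2_eq_square algebra_simps)
    have "e j \<le> t * r ^ j" using weak[of j] weak2[of j] Suc by simp
    then have "e (Suc j) \<le> r * e j + A * s * (e j + t)" using step[of j] Suc by (simp add: s_def)
    also have "\<dots> = (r + A * s) * e j + A * s * t" by (simp add: algebra_simps)
    also have "\<dots> \<le> (r + A * s) * (G * exp (Q * s) * t * s) + A * s * t"
      using IH r A s by (intro add_mono mult_left_mono) auto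
    also have "\<dots> \<le> (r * exp (A * s)) * (G * exp (Q * s) * t * s) + (r * exp (Q * (r * s))) * (A * s * t)"
    proof (intro add_mono mult_right_mono)
      have "A * s * 1 \<le> A * s * r" using A r s by (intro mult_left_mono) auto
      then have "r + A * s \<le> r * (1 + A * s)" by (simp add: algebra_simps)
      also have "\<dots> \<le> r * exp (A * s)" using r by (intro mult_left_mono exp_ge_add_one_self) auto
      finally show "r + A * s \<le> r * exp (A * s)" .
      show "0 \<le> G * exp (Q * s) * t * s" using G t s by simp
      have "1 * 1 \<le> r * exp (Q * (r * s))" using r Q s by (intro mult_mono) auto
      then have "1 * (A * s * t) \<le> (r * exp (Q * (r * s))) * (A * s * t)"
        using A s t by (intro mult_right_mono) auto
      then show "A * s * t \<le> (r * exp (Q * (r * s))) * (A * s * t)" by simp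
    qed
    also have "\<dots> = (G + A) * exp (Q * (r * s)) * t * (r * s)"
    proof -
      have "Q * (r * s) = A * s + Q * s" using Q(2) by (metis distrib_right mult.assoc)
      then have "exp (Q * (r * s)) = exp (A * s) * exp (Q * s)" by (simp add: exp_add)
      then show ?thesis by (simp add: algebra_simps)
    qed
    finally show ?case by (simp add: s_def G_def power2_eq_square algebra_simps)
  qed
  then show "e j \<le> (B + A * j) * exp (A / (r - 1)) * t\<^sup>2 * r ^ j"
    using weak[OF j] by (simp add: Q_def)
  then show "e j \<le> t * r ^ j" using weak2[OF j] by (simp add: Q_def)
qed

section \<open>Rescaled orbits near the repelling cycle\<close>

text \<open>
  The main estimate. To first order in \<open>u\<close>, the map \<open>f\<^bsub>c0 + u\<^esub>\<^sup>p\<close> has its fixed point at \<open>a - \<sigma> u\<close>, so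
  the starting point \<open>v\<close> has the same position relative to it as \<open>a + w / \<rho>\<^sup>n\<close> has relative to \<open>a\<close>. For
  the first \<open>n - J\<close> rounds, with \<open>J\<close> fixed, both orbits stay so close to \<open>a\<close> that the growth
  estimates apply; the last \<open>J\<close> rounds enlarge distances by at most a fixed factor. The
  bound by \<open>M\<close> is what Montel's theorem requires.
\<close>

lemma rescaled_iterates_close:
  fixes c0 a :: complex and U B W :: real and p :: nat
  defines "\<rho> \<equiv> space_deriv c0 a p"
  defines "\<sigma> \<equiv> param_deriv c0 a p / (\<rho> - 1)"
  assumes per: "(quad c0 ^^ p) a = a" and rep: "norm \<rho> > 1"
    and W: "W > 0" and U: "U \<ge> 0" and B: "B \<ge> 0"
  obtains M where "\<forall>\<epsilon>>0. \<exists>n1. \<forall>n\<ge>n1. \<forall>w u v.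
      norm w \<le> W \<longrightarrow> norm u \<le> U / norm \<rho> ^ n \<longrightarrow>
      norm (v - (a + w / \<rho> ^ n - \<sigma> * u)) \<le> B / (norm \<rho> ^ n)\<^sup>2 \<longrightarrow>
      norm ((quad (c0 + u) ^^ (p * n)) v - (quad c0 ^^ (p * n)) (a + w / \<rho> ^ n)) < \<epsilon> \<and>
      norm ((quad c0 ^^ (p * n)) (a + w / \<rho> ^ n)) \<le> M"
proof -
  define r where "r = norm \<rho>"
  have r: "r > 1" using rep by (simp add: r_def)
  have \<sigma>: "\<sigma> * (\<rho> - 1) = param_deriv c0 a p" using rep by (auto simp: \<sigma>_def)
  obtain C where C: "C \<ge> 0" and est: "\<And>c x y. norm (c - c0) \<le> 1 \<Longrightarrow> norm (x - a) \<le> 1 \<Longrightarrow> norm (y - a) \<le> 1 \<Longrightarrow>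
    norm ((quad c ^^ p) x - (quad c0 ^^ p) y - \<rho> * (x - y) - param_deriv c0 a p * (c - c0))
      \<le> C * (norm (c - c0) + norm (x - a) + norm (y - a)) * (norm (x - y) + norm (c - c0))"
    using iterate_expansion[of c0 a p] unfolding \<rho>_def by blast
  obtain \<eta> where \<eta>: "\<eta> > 0" "2 * W * \<eta> \<le> 1" and growth:
    "\<And>z N t j. t > 0 \<Longrightarrow> z 0 \<le> W * t \<Longrightarrow> t * r ^ N \<le> \<eta> \<Longrightarrow>
      (\<And>j. j < N \<Longrightarrow> z j \<le> 1 \<Longrightarrow> z (Suc j) \<le> r * z j + C * (z j)\<^sup>2) \<Longrightarrow> (\<And>j. z j \<ge> 0) \<Longrightarrow>
      j \<le> N \<Longrightarrow> z j \<le> 2 * W * (t * r ^ j)"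
    using growth_bound[OF r W C] by metis
  define S where "S = norm \<sigma>"
  have S: "S \<ge> 0" by (simp add: S_def)
  define D where "D = 1 + 2 * W + S * U + U"
  have D: "D \<ge> 1" using W S U by (simp add: D_def)
  define A where "A = C * (D + 2 * W) * (1 + (S + 1) * U)"
  have A: "A \<ge> 0" using C W D S U by (simp add: A_def)
  define Q where "Q = exp (A / (r - 1))"
  have Q: "Q \<ge> 1" using A r by (simp add: Q_def)
  obtain J where "(1 / r) ^ J < min \<eta> (1 / D)"
    using real_arch_pow_inv[of "min \<eta> (1 / D)" "1 / r"] r \<eta> D by auto
  then have J: "1 / r ^ J \<le> \<eta>" "D * (1 / r ^ J) \<le> 1" using D r
    by (auto simp: power_divide field_simps)
  have J1: "1 / r ^ J \<le> 1" using r by simp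
  obtain L where L: "L \<ge> 0" and lip: "\<And>c x y. norm (c - c0) \<le> 1 \<Longrightarrow> norm (x - a) \<le> 1 \<Longrightarrow> norm (y - a) \<le> 1 \<Longrightarrow>
    norm ((quad c ^^ (p * J)) x - (quad c0 ^^ (p * J)) y) \<le> L * (norm (x - y) + norm (c - c0))"
    using iterate_lipschitz[of c0 a "p * J"] by blast
  \<comment> \<open>Bounds the distance of the orbits after \<open>n - J\<close> rounds plus the distance of the parameters.\<close>
  define g where "g = (\<lambda>n. ((B + A * real n) * Q + (S + 1) * U) / r ^ n)"
  have g: "g \<longlonglongrightarrow> 0"
  proof -
    have "(\<lambda>n. (B * Q + (S + 1) * U) * (inverse r ^ n) + A * Q * (real n / r ^ n)) \<longlonglongrightarrow>
        (B * Q + (S + 1) * U) * 0 + A * Q * 0"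
      using r by (intro tendsto_add tendsto_mult tendsto_const LIMSEQ_inverse_realpow_zero
        LIMSEQ_power_zero lim_n_over_pown) (auto simp: field_simps)
    moreover have "g = (\<lambda>n. (B * Q + (S + 1) * U) * (inverse r ^ n) + A * Q * (real n / r ^ n))"
      unfolding g_def using r by (simp add: field_simps power_inverse fun_eq_iff)
    ultimately show ?thesis by simp
  qed
  have main: "norm ((quad (c0 + u) ^^ (p * n)) v - (quad c0 ^^ (p * n)) (a + w / \<rho> ^ n)) \<le> L * g n \<and>
      norm ((quad c0 ^^ (p * n)) (a + w / \<rho> ^ n)) \<le> norm a + L"
    if n: "n \<ge> J" and gn: "g n \<le> 1"
      and w: "norm w \<le> W" and u: "norm u \<le> U / norm \<rho> ^ n"
      and v: "norm (v - (a + w / \<rho> ^ n - \<sigma> * u)) \<le> B / (norm \<rho> ^ n)\<^sup>2" for n w u v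
  proof -
    define t where "t = 1 / r ^ n"
    define N where "N = n - J"
    have t: "t > 0" using r by (simp add: t_def)
    have tN: "t * r ^ N = 1 / r ^ J"
      using n r by (simp add: t_def N_def power_diff)
    have tj: "t \<le> t * r ^ j" "t * r ^ j \<le> 1 / r ^ J" if "j \<le> N" for j
    proof -
      have "r ^ j \<le> r ^ N" using r that by (intro power_increasing) auto
      then show "t * r ^ j \<le> 1 / r ^ J" using t tN by (metis mult_left_mono less_imp_le)
      show "t \<le> t * r ^ j" using t r by simp
    qed
    define c where "c = c0 + u"
    define x where "x = (\<lambda>j. (quad c ^^ (p * j)) v)"
    define y where "y = (\<lambda>j. (quad c0 ^^ (p * j)) (a + w / \<rho> ^ n))"
    have xs: "x (Suc j) = (quad c ^^ p) (x j)" and ys: "y (Suc j) = (quad c0 ^^ p) (y j)" for j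
      by (simp_all add: x_def y_def funpow_add)
    have ut: "norm u \<le> U * t" using u by (simp add: t_def r_def)
    have u1: "norm (c - c0) \<le> 1"
    proof -
      have "U * t \<le> D * (1 / r ^ J)" using tj[of 0] U t W S by (intro mult_mono) (auto simp: D_def)
      then show ?thesis using ut J by (simp add: c_def)
    qed
    have yb: "norm (y j - a) \<le> 2 * W * (t * r ^ j)" if "j \<le> N" for j
    proof (rule growth[of t "\<lambda>j. norm (y j - a)" N])
      show "norm (y 0 - a) \<le> W * t"
        using w r by (simp add: y_def t_def norm_divide norm_power r_def divide_right_mono)
      show "norm (y (Suc i) - a) \<le> r * norm (y i - a) + C * (norm (y i - a))\<^sup>2"
        if "norm (y i - a) \<le> 1" for i
      proof -
        have "norm (y (Suc i) - a - \<rho> * (y i - a)) \<le> C * (norm (y i - a))\<^sup>2"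
          using est[of c0 "y i" a] that by (simp add: ys per power2_eq_square algebra_simps)
        moreover have "norm (y (Suc i) - a) \<le> norm (\<rho> * (y i - a)) + norm (y (Suc i) - a - \<rho> * (y i - a))"
          by norm
        ultimately show ?thesis by (simp add: norm_mult r_def)
      qed
    qed (use t tN J that in auto)
    have yb1: "norm (y j - a) \<le> 1" if "j \<le> N" for j
    proof -
      have "2 * W * (t * r ^ j) \<le> 2 * W * \<eta>"
        using tj[OF that] J W by (intro mult_left_mono) auto
      then show ?thesis using yb[OF that] \<eta> by linarith
    qed
    define e where "e = (\<lambda>j. norm (x j - y j + \<sigma> * u))"
    have xy: "norm (x j - y j) \<le> e j + S * norm u" for j
    proof -
      have "norm (x j - y j) \<le> norm (x j - y j + \<sigma> * u) + norm (\<sigma> * u)" by norm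
      then show ?thesis by (simp add: e_def S_def norm_mult)
    qed
    have SU: "S * norm u \<le> S * U * (t * r ^ j)" "norm u \<le> U * (t * r ^ j)" if "j \<le> N" for j
    proof -
      have "U * t \<le> U * (t * r ^ j)" using tj(1)[OF that] U by (intro mult_left_mono)
      then show *: "norm u \<le> U * (t * r ^ j)" using ut by linarith
      show "S * norm u \<le> S * U * (t * r ^ j)"
        using mult_left_mono[OF * S] by (simp add: mult.assoc)
    qed
    have xb: "norm (x j - a) \<le> (1 + 2 * W + S * U) * (t * r ^ j)" if "j \<le> N" "e j \<le> t * r ^ j" for j
    proof -
      have "norm (x j - a) \<le> norm (x j - y j) + norm (y j - a)" by norm
      also have "\<dots> \<le> t * r ^ j + S * U * (t * r ^ j) + 2 * W * (t * r ^ j)"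
        using xy[of j] yb[of j] SU[of j] that by simp
      finally show ?thesis by (simp add: algebra_simps)
    qed
    have xb1: "norm (x j - a) \<le> 1" if "j \<le> N" "e j \<le> t * r ^ j" for j
    proof -
      have "(1 + 2 * W + S * U) * (t * r ^ j) \<le> D * (1 / r ^ J)"
        using tj[OF that(1)] t r D U by (intro mult_mono) (auto simp: D_def)
      then show ?thesis using xb[OF that] J by linarith
    qed
    have step: "e (Suc j) \<le> r * e j + A * (t * r ^ j) * (e j + t)"
      if j: "j < N" and ej: "e j \<le> t * r ^ j" for j
    proof -
      define s where "s = t * r ^ j"
      have s: "s > 0" using t r by (simp add: s_def)
      have e_nn: "e j \<ge> 0" by (simp add: e_def)
      define E where "E = x (Suc j) - y (Suc j) - \<rho> * (x j - y j) - param_deriv c0 a p * (c - c0)"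
      have "norm E \<le> C * (norm (c - c0) + norm (x j - a) + norm (y j - a)) * (norm (x j - y j) + norm (c - c0))"
        unfolding E_def xs ys using u1 xb1[of j] yb1[of j] j ej by (intro est) auto
      also have "\<dots> \<le> C * ((D + 2 * W) * s) * (e j + (S + 1) * U * t)"
      proof (intro mult_mono mult_left_mono)
        have "norm (c - c0) + norm (x j - a) + norm (y j - a) \<le> U * s + (1 + 2 * W + S * U) * s + 2 * W * s"
          using SU(2)[of j] xb[of j] yb[of j] j ej by (simp add: s_def c_def)
        also have "\<dots> = (D + 2 * W) * s" by (simp add: D_def algebra_simps)
        finally show "norm (c - c0) + norm (x j - a) + norm (y j - a) \<le> (D + 2 * W) * s" .
        have "(S + 1) * norm u \<le> (S + 1) * (U * t)" using ut S by (intro mult_left_mono) auto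
        then show "norm (x j - y j) + norm (c - c0) \<le> e j + (S + 1) * U * t"
          using xy[of j] by (simp add: c_def algebra_simps)
      qed (use C D W s in auto)
      also have "\<dots> = C * (D + 2 * W) * s * (e j + (S + 1) * U * t)" by simp
      also have "\<dots> \<le> C * (D + 2 * W) * s * ((1 + (S + 1) * U) * (e j + t))"
      proof (intro mult_left_mono)
        have "0 \<le> (S + 1) * U * e j" using S U e_nn by simp
        then show "e j + (S + 1) * U * t \<le> (1 + (S + 1) * U) * (e j + t)"
          using t by (simp add: algebra_simps)
      qed (use C D W s in auto)
      also have "\<dots> = A * s * (e j + t)" by (simp add: A_def)
      finally have E: "norm E \<le> A * s * (e j + t)" .
      \<comment> \<open>\<open>\<sigma>\<close> solves \<open>\<sigma> (\<rho> - 1) = \<partial>\<^sub>c f\<^sup>p\<close>, so the corrected difference is multiplied by \<open>\<rho>\<close> up to \<open>E\<close>.\<close>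
      have "x (Suc j) - y (Suc j) + \<sigma> * u = E + \<rho> * (x j - y j) + (\<sigma> * (\<rho> - 1)) * u + \<sigma> * u"
        unfolding \<sigma> by (simp add: E_def c_def)
      also have "\<dots> = E + \<rho> * (x j - y j + \<sigma> * u)" by (simp add: algebra_simps)
      finally have "e (Suc j) \<le> norm E + norm (\<rho> * (x j - y j + \<sigma> * u))"
        unfolding e_def by (simp only: norm_triangle_ineq)
      then show ?thesis using E by (simp add: norm_mult e_def r_def s_def)
    qed
    have gt: "g n = ((B + A * real n) * Q + (S + 1) * U) * t"
      by (simp add: g_def t_def)
    have BN: "(B + A * real N) * Q \<le> (B + A * real n) * Q"
      using A Q by (intro mult_right_mono add_left_mono mult_left_mono) (auto simp: N_def)
    have SU0: "(S + 1) * U * t \<ge> 0" using S U t by simp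
    have tN1: "t * r ^ N \<le> 1" using tN J1 by simp
    have small: "(B + A * real N) * Q * t \<le> 1"
    proof -
      have "(B + A * real N) * Q * t \<le> (B + A * real n) * Q * t"
        by (rule mult_right_mono[OF BN less_imp_le[OF t]])
      also have "\<dots> \<le> g n" using SU0 by (simp add: gt algebra_simps)
      finally show ?thesis using gn by simp
    qed
    have e0: "e 0 \<le> B * t\<^sup>2"
    proof -
      have "x 0 - y 0 + \<sigma> * u = v - (a + w / \<rho> ^ n - \<sigma> * u)" by (simp add: x_def y_def)
      then have "e 0 \<le> B / (r ^ n)\<^sup>2" using v by (simp only: e_def r_def)
      then show ?thesis by (simp add: t_def power_divide)
    qed
    have eN: "e N \<le> (B + A * N) * Q * t\<^sup>2 * r ^ N" "e N \<le> t * r ^ N"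
      using difference_bound[OF r A B t tN1, of e N] e0 small step unfolding Q_def by auto
    have "norm (x N - y N) + norm u \<le> g n"
    proof -
      have "norm (x N - y N) + norm u \<le> e N + (S + 1) * norm u"
        using xy[of N] by (simp add: algebra_simps)
      also have "\<dots> \<le> (B + A * N) * Q * t * (t * r ^ N) + (S + 1) * (U * t)"
        using eN(1) ut S by (intro add_mono mult_left_mono) (auto simp: power2_eq_square mult_ac)
      also have "\<dots> \<le> (B + A * N) * Q * t * 1 + (S + 1) * (U * t)"
        using tN1 A B Q t S U by (intro add_mono mult_left_mono) auto
      also have "\<dots> \<le> (B + A * n) * Q * t + (S + 1) * (U * t)"
        using mult_right_mono[OF BN less_imp_le[OF t]] by simp
      finally show ?thesis by (simp add: gt algebra_simps)
    qed
    moreover have "norm ((quad c ^^ (p * J)) (x N) - (quad c0 ^^ (p * J)) (y N)) \<le> L * (norm (x N - y N) + norm u)"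
      using lip[of c "x N" "y N"] u1 xb1[of N] eN yb1[of N] by (simp add: c_def)
    moreover have pn: "p * n = p * J + p * N" using n by (simp add: N_def flip: distrib_left)
    ultimately have 1: "norm ((quad c ^^ (p * n)) v - (quad c0 ^^ (p * n)) (a + w / \<rho> ^ n)) \<le> L * g n"
      using L unfolding pn funpow_add x_def y_def comp_def by (meson mult_left_mono order_trans)
    have aJ: "(quad c0 ^^ (p * J)) a = a"
      unfolding funpow_mult[symmetric] by (induction J) (simp_all add: per)
    have "norm ((quad c0 ^^ (p * J)) (y N) - a) \<le> L * norm (y N - a)"
      using lip[of c0 "y N" a] yb1[of N] by (simp add: aJ)
    also have "\<dots> \<le> L * 1" using yb1[of N] L by (intro mult_left_mono) auto
    finally have "norm ((quad c0 ^^ (p * n)) (a + w / \<rho> ^ n) - a) \<le> L"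
      unfolding pn funpow_add y_def comp_def by simp
    then have "norm ((quad c0 ^^ (p * n)) (a + w / \<rho> ^ n)) \<le> norm a + L"
      by norm
    with 1 show ?thesis by (simp add: c_def)
  qed
  show thesis
  proof (rule that, intro allI impI)
    fix \<epsilon> :: real assume \<epsilon>: "\<epsilon> > 0"
    have "\<forall>\<^sub>F n in sequentially. g n < min 1 (\<epsilon> / (L + 1))"
      using g \<epsilon> L by (intro order_tendstoD(2)[OF g]) auto
    then obtain n0 where n0: "\<And>n. n \<ge> n0 \<Longrightarrow> g n < min 1 (\<epsilon> / (L + 1))"
      by (auto simp: eventually_sequentially)
    show "\<exists>n1. \<forall>n\<ge>n1. \<forall>w u v.
      norm w \<le> W \<longrightarrow> norm u \<le> U / norm \<rho> ^ n \<longrightarrow>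
      norm (v - (a + w / \<rho> ^ n - \<sigma> * u)) \<le> B / (norm \<rho> ^ n)\<^sup>2 \<longrightarrow>
      norm ((quad (c0 + u) ^^ (p * n)) v - (quad c0 ^^ (p * n)) (a + w / \<rho> ^ n)) < \<epsilon> \<and>
      norm ((quad c0 ^^ (p * n)) (a + w / \<rho> ^ n)) \<le> norm a + L"
    proof (intro exI[of _ "max n0 J"] allI impI)
      fix n w u v
      assume h: "max n0 J \<le> n" "norm w \<le> W" "norm u \<le> U / norm \<rho> ^ n"
        "norm (v - (a + w / \<rho> ^ n - \<sigma> * u)) \<le> B / (norm \<rho> ^ n)\<^sup>2"
      have gn: "g n < 1" "g n < \<epsilon> / (L + 1)" using n0[of n] h by auto
      have "L * g n \<le> L * (\<epsilon> / (L + 1))" using gn L by (intro mult_left_mono) auto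
      also have "\<dots> < \<epsilon>" using L \<epsilon> by (simp add: field_simps)
      finally show "norm ((quad (c0 + u) ^^ (p * n)) v - (quad c0 ^^ (p * n)) (a + w / \<rho> ^ n)) < \<epsilon> \<and>
        norm ((quad c0 ^^ (p * n)) (a + w / \<rho> ^ n)) \<le> norm a + L"
        using main[of n w u v] h gn by auto
    qed
  qed
qed

section \<open>Uniform convergence and the spherical metric\<close>

text \<open>
  This expresses the great-circle distance through the chordal one, so that uniform closeness in the
  plane implies uniform closeness on the sphere, even on unbounded sets.
\<close>

lemma stereo_inner:
  "stereo (Some z) \<bullet> stereo (Some w) =
    1 - 2 * (norm (z - w))\<^sup>2 / ((1 + (norm z)\<^sup>2) * (1 + (norm w)\<^sup>2))"
proof -
  define A B D where "A = (norm z)\<^sup>2" and "B = (norm w)\<^sup>2" and "D = z \<bullet> w"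
  have AB: "A \<ge> 0" "B \<ge> 0" by (simp_all add: A_def B_def)
  then have nz: "1 + A \<noteq> 0" "1 + B \<noteq> 0" by linarith+
  have d: "(norm (z - w))\<^sup>2 = A + B - 2 * D"
    by (simp add: A_def B_def D_def power2_norm_eq_inner inner_diff_left inner_diff_right inner_commute)
  have "stereo (Some z) \<bullet> stereo (Some w) =
      (2 / (1 + A)) * (2 / (1 + B)) * D + ((A - 1) / (1 + A)) * ((B - 1) / (1 + B))"
    by (simp add: stereo_def inner_prod_def A_def B_def D_def add.commute)
  also have "\<dots> = 1 - 2 * (A + B - 2 * D) / ((1 + A) * (1 + B))"
    using nz by (simp add: divide_simps) (simp add: algebra_simps)
  finally show ?thesis by (simp add: d A_def B_def)
qed

lemma spherical_dist_small:
  assumes "e > 0"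
  obtains d where "d > 0" "\<And>z w. norm (z - w) < d \<Longrightarrow> spherical_dist (Some z) (Some w) < e"
proof -
  define e' where "e' = min e 1"
  have e': "0 < e'" "e' \<le> pi" "e' \<le> e" using assms pi_gt3 by (auto simp: e'_def)
  have cos1: "cos e' < 1" using cos_monotone_0_pi[of 0 e'] e' by simp
  \<comment> \<open>By \<open>stereo_inner\<close> the inner product is at least \<open>1 - 2 |z - w|\<^sup>2\<close>, which exceeds \<open>cos e'\<close> if \<open>|z - w| < d\<close>.\<close>
  define d where "d = sqrt ((1 - cos e') / 2)"
  show thesis
  proof
    show "d > 0" using cos1 by (simp add: d_def)
    fix z w :: complex assume zw: "norm (z - w) < d"
    define y where "y = stereo (Some z) \<bullet> stereo (Some w)"
    define E where "E = (1 + (norm z)\<^sup>2) * (1 + (norm w)\<^sup>2)"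
    have "1 * 1 \<le> E" unfolding E_def by (intro mult_mono) auto
    then have E: "E \<ge> 1" by simp
    have y: "y = 1 - 2 * (norm (z - w))\<^sup>2 / E" by (simp add: y_def stereo_inner E_def)
    have "2 * (norm (z - w))\<^sup>2 / E \<le> 2 * (norm (z - w))\<^sup>2"
      using E by (simp add: divide_le_eq mult_le_cancel_left1)
    also have "(norm (z - w))\<^sup>2 < d\<^sup>2" using zw by (intro power_strict_mono) auto
    then have "2 * (norm (z - w))\<^sup>2 < 1 - cos e'" using cos1 by (simp add: d_def)
    finally have "cos e' < y" by (simp add: y)
    moreover have "y \<le> 1" using E by (simp add: y)
    ultimately have "arccos y < arccos (cos e')" by (intro arccos_less_arccos) auto
    also have "\<dots> = e'" using e' by (intro arccos_cos) auto
    finally show "spherical_dist (Some z) (Some w) < e"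
      using e' by (simp add: spherical_dist_def y_def)
  qed
qed

lemma to_sphere_holomorphic: "f holomorphic_on UNIV \<Longrightarrow> to_sphere f z = Some (f z)"
  using not_is_pole_holomorphic[of UNIV z f] by (simp add: to_sphere_def)

lemma uniform_limit_imp_spherically_converges:
  assumes lim: "\<And>R. uniform_limit (cball 0 R) G g sequentially"
    and G: "\<And>k. G k holomorphic_on UNIV" and g: "g holomorphic_on UNIV"
  shows "spherically_converges G g"
  unfolding spherically_converges_def
proof (intro allI impI)
  fix K :: "complex set" and e :: real
  assume "compact K" and "e > 0"
  obtain R where "\<And>z. z \<in> K \<Longrightarrow> norm z \<le> R"
    using compact_imp_bounded[OF \<open>compact K\<close>] unfolding bounded_iff by blast
  then have R: "K \<subseteq> cball 0 R" by auto
  obtain d where d: "d > 0" "\<And>z w. norm (z - w) < d \<Longrightarrow> spherical_dist (Some z) (Some w) < e"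
    using spherical_dist_small[OF \<open>e > 0\<close>] by blast
  have "\<forall>\<^sub>F k in sequentially. \<forall>z\<in>cball 0 R. dist (G k z) (g z) < d"
    using lim[of R] d(1) by (simp add: uniform_limit_iff)
  then show "\<forall>\<^sub>F k in sequentially. \<forall>z\<in>K.
      spherical_dist (to_sphere (G k) z) (to_sphere g z) < e"
    by eventually_elim (use R d(2) G g in \<open>auto simp: to_sphere_holomorphic dist_norm subset_iff\<close>)
qed

lemma zalcmanI:
  assumes \<phi>: "\<phi> holomorphic_on UNIV" "\<not> \<phi> constant_on UNIV"
    and F: "\<And>k. F k \<in> \<F>" "\<And>k. F k holomorphic_on UNIV"
    and \<alpha>: "\<And>k. \<alpha> k \<noteq> 0" "\<alpha> \<longlonglongrightarrow> 0"
    and lim: "\<And>R. uniform_limit (cball 0 R) (\<lambda>k s. F k (\<alpha> k * s + z0)) \<phi> sequentially"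
  shows "\<phi> \<in> zalcman \<F> z0"
proof -
  define A where "A = (\<lambda>k s. \<alpha> k * s + z0)"
  have hol: "A k holomorphic_on UNIV" for k
    unfolding A_def by (intro holomorphic_intros)
  have "A k \<in> Aff" for k using \<alpha> by (auto simp: Aff_def A_def)
  moreover have "spherically_converges A (\<lambda>_. z0)"
  proof (rule uniform_limit_imp_spherically_converges)
    fix R :: real
    show "uniform_limit (cball 0 R) A (\<lambda>_. z0) sequentially"
      unfolding uniform_limit_iff
    proof (intro allI impI)
      fix e :: real assume "e > 0"
      then have "\<forall>\<^sub>F k in sequentially. norm (\<alpha> k) < e / (\<bar>R\<bar> + 1)"
        using order_tendstoD(2)[OF tendsto_norm_zero[OF \<alpha>(2)], of "e / (\<bar>R\<bar> + 1)"] by simp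
      then show "\<forall>\<^sub>F k in sequentially. \<forall>s\<in>cball 0 R. dist (A k s) z0 < e"
      proof eventually_elim
        case (elim k)
        show ?case
        proof
          fix s :: complex assume "s \<in> cball 0 R"
          then have "norm (\<alpha> k) * norm s \<le> norm (\<alpha> k) * (\<bar>R\<bar> + 1)"
            by (intro mult_left_mono) auto
          also have "\<dots> < e" using elim by (simp add: field_simps)
          finally show "dist (A k s) z0 < e" by (simp add: A_def dist_norm norm_mult)
        qed
      qed
    qed
  qed (use hol in auto)
  moreover have "spherically_converges (\<lambda>k. F k \<circ> A k) \<phi>"
  proof (rule uniform_limit_imp_spherically_converges)
    show "uniform_limit (cball 0 R) (\<lambda>k. F k \<circ> A k) \<phi> sequentially" for R
      using lim[of R] by (simp add: A_def comp_def)
    show "F k \<circ> A k holomorphic_on UNIV" for k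
      using holomorphic_on_compose_gen[OF hol[of k] F(2)[of k]] by simp
  qed (fact \<phi>)
  moreover have "\<phi> nicely_meromorphic_on UNIV"
    using \<phi>(1) by (intro analytic_on_imp_nicely_meromorphic_on) (simp add: analytic_on_open)
  ultimately show ?thesis
    unfolding zalcman_def mem_Collect_eq
    by (intro conjI exI[of _ A] exI[of _ F] allI) (use \<phi>(2) F(1) in auto)
qed

lemma holomorphic_on_iterate: "(quad c ^^ n) holomorphic_on UNIV"
proof (induction n)
  case (Suc n)
  have "quad c ^^ Suc n = (\<lambda>z. ((quad c ^^ n) z)\<^sup>2 + c)"
    by (rule ext) (rule iterate_Suc)
  then show ?case using Suc by (simp only:) (intro holomorphic_intros)
qed (auto simp: id_def)

lemma holomorphic_on_iterate_diagonal: "(\<lambda>c. (quad c ^^ n) c) holomorphic_on UNIV"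
proof (induction n)
  case (Suc n)
  then show ?case unfolding iterate_Suc by (intro holomorphic_intros)
qed simp

section \<open>The common Zalcman function\<close>

text \<open>
  A Poincare function at \<open>a\<close>. The whole sequence converges, but a subsequence is enough here, and it
  comes directly from Montel's theorem.
\<close>

lemma exists_common_limit:
  fixes c0 a :: complex
  assumes per: "(quad c0 ^^ p) a = a" and rep: "norm (space_deriv c0 a p) > 1"
  defines "\<rho> \<equiv> space_deriv c0 a p"
  obtains \<phi> s where "\<phi> holomorphic_on UNIV" "\<not> \<phi> constant_on UNIV" "strict_mono (s :: nat \<Rightarrow> nat)"
    "\<forall>R. uniform_limit (cball 0 R) (\<lambda>k w. (quad c0 ^^ (p * s k)) (a + w / \<rho> ^ s k)) \<phi> sequentially"
proof -
  have \<rho>: "norm \<rho> > 1" using rep by (simp add: \<rho>_def)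
  then have \<rho>0: "\<rho> \<noteq> 0" by auto
  define h where "h = (\<lambda>n w. (quad c0 ^^ (p * n)) (a + w / \<rho> ^ n))"
  have hol: "h n holomorphic_on S" for n S
  proof -
    have "(\<lambda>z. (quad c0 ^^ (p * n)) z) \<circ> (\<lambda>w. a + w / \<rho> ^ n) holomorphic_on S"
      using \<rho>0 by (intro holomorphic_on_compose_gen[OF _ holomorphic_on_iterate] holomorphic_intros) auto
    then show ?thesis by (simp add: h_def comp_def)
  qed
  have bounded: "\<exists>B. \<forall>f \<in> range h. \<forall>z \<in> K. norm (f z) \<le> B" if K: "compact K" for K
  proof -
    obtain W where W: "W > 0" "\<And>z. z \<in> K \<Longrightarrow> norm z \<le> W"
      using compact_imp_bounded[OF K] bounded_pos by metis
    \<comment> \<open>The bound \<open>M\<close> is uniform in \<open>w\<close> and in large \<open>n\<close>; it is extracted from the case \<open>u = 0\<close>.\<close>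
    obtain M where "\<forall>\<epsilon>>0. \<exists>n1. \<forall>n\<ge>n1. \<forall>w u v.
      norm w \<le> W \<longrightarrow> norm u \<le> 0 / norm \<rho> ^ n \<longrightarrow>
      norm (v - (a + w / \<rho> ^ n - param_deriv c0 a p / (\<rho> - 1) * u)) \<le> 0 / (norm \<rho> ^ n)\<^sup>2 \<longrightarrow>
      norm ((quad (c0 + u) ^^ (p * n)) v - (quad c0 ^^ (p * n)) (a + w / \<rho> ^ n)) < \<epsilon> \<and>
      norm ((quad c0 ^^ (p * n)) (a + w / \<rho> ^ n)) \<le> M"
      by (rule rescaled_iterates_close[OF per rep W(1) order_refl order_refl, folded \<rho>_def])
    from this[THEN spec[of _ 1], THEN mp]
    obtain n1 where "\<forall>n\<ge>n1. \<forall>w u v.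
      norm w \<le> W \<longrightarrow> norm u \<le> 0 / norm \<rho> ^ n \<longrightarrow>
      norm (v - (a + w / \<rho> ^ n - param_deriv c0 a p / (\<rho> - 1) * u)) \<le> 0 / (norm \<rho> ^ n)\<^sup>2 \<longrightarrow>
      norm ((quad (c0 + u) ^^ (p * n)) v - (quad c0 ^^ (p * n)) (a + w / \<rho> ^ n)) < 1 \<and>
      norm ((quad c0 ^^ (p * n)) (a + w / \<rho> ^ n)) \<le> M"
      by auto
    from this[rule_format, of _ _ 0 "a + _ / \<rho> ^ _"]
    have n1: "norm (h n w) \<le> M" if "n \<ge> n1" "norm w \<le> W" for n w
      using that by (simp add: h_def)
    have "\<exists>B. \<forall>z\<in>K. norm (h n z) \<le> B" for n
      using compact_imp_bounded[OF compact_continuous_image[OF holomorphic_on_imp_continuous_on[OF hol] K]]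
      by (auto simp: bounded_iff)
    then obtain b where b: "\<And>n z. z \<in> K \<Longrightarrow> norm (h n z) \<le> b n" by metis
    \<comment> \<open>Finitely many small \<open>n\<close> are left, for which continuity suffices.\<close>
    have "norm (h n z) \<le> Max (insert M (b ` {..<n1}))" if "z \<in> K" for n z
    proof (cases "n \<ge> n1")
      case True
      then show ?thesis using n1[of n z] W(2)[OF that] by (intro Max.coboundedI[THEN order_trans[rotated]]) auto
    next
      case False
      then show ?thesis using b[OF that, of n] by (intro Max.coboundedI[THEN order_trans[rotated]]) auto
    qed
    then show ?thesis by blast
  qed
  obtain \<phi> s where \<phi>: "\<phi> holomorphic_on UNIV" and s: "strict_mono (s :: nat \<Rightarrow> nat)"
    and lim: "\<And>K. compact K \<Longrightarrow> K \<subseteq> UNIV \<Longrightarrow> uniform_limit K (h \<circ> s) \<phi> sequentially"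
    using Montel[of UNIV "range h" h] hol bounded by (metis (no_types, lifting) image_iff open_UNIV order_refl)
  have lim': "uniform_limit (cball 0 R) (h \<circ> s) \<phi> sequentially" for R
    by (intro lim) auto
  have "(\<lambda>k. deriv ((h \<circ> s) k) 0) \<longlonglongrightarrow> deriv \<phi> 0"
    using higher_deriv_complex_uniform_limit[where A = "ball 0 1" and f = "h \<circ> s" and g = \<phi>
        and F = sequentially and z = 0 and m = 1]
      uniform_limit_on_subset[OF lim'[of 1], of "ball 0 1"] hol by auto
  moreover have "deriv (h n) 0 = 1" for n
  proof -
    have mult: "((quad c0 ^^ (p * n)) has_field_derivative \<rho> ^ n) (at a)"
    proof (induction n)
      case (Suc n)
      have fix_n: "(quad c0 ^^ (p * n)) a = a"
        unfolding funpow_mult[symmetric] by (induction n) (simp_all add: per)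
      have "(quad c0 ^^ p \<circ> quad c0 ^^ (p * n) has_field_derivative \<rho> * \<rho> ^ n) (at a)"
        using Suc has_field_derivative_iterate[where c = c0 and n = p and z = a]
        by (intro DERIV_chain) (simp_all add: fix_n \<rho>_def)
      then show ?case by (simp only: mult_Suc_right funpow_add power_Suc)
    qed simp
    have "((\<lambda>w. a + w / \<rho> ^ n) has_field_derivative 1 / \<rho> ^ n) (at 0)"
      using \<rho>0 by (auto intro!: derivative_eq_intros)
    then have "((quad c0 ^^ (p * n)) \<circ> (\<lambda>w. a + w / \<rho> ^ n) has_field_derivative \<rho> ^ n * (1 / \<rho> ^ n)) (at 0)"
      using mult by (intro DERIV_chain) simp_all
    then show ?thesis using \<rho>0 by (simp add: h_def comp_def DERIV_imp_deriv)
  qed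
  ultimately have "deriv \<phi> 0 = 1" by (simp add: LIMSEQ_const_iff)
  have "\<not> \<phi> constant_on UNIV"
  proof
    assume "\<phi> constant_on UNIV"
    then obtain k where "\<phi> = (\<lambda>_. k)" by (auto simp: constant_on_def)
    with \<open>deriv \<phi> 0 = 1\<close> show False by simp
  qed
  then show thesis using that[OF \<phi> _ s] lim' by (simp add: h_def comp_def)
qed

text \<open>
  Both families are covered by one statement: \<open>h = w / \<rho>\<^sup>n\<close> is the scaled variable, \<open>c0 + \<mu> h\<close> the
  parameter and \<open>x h\<close> the point reached after \<open>l\<close> steps. The dynamical family has \<open>\<mu> = 0\<close>, the
  parameter family has \<open>\<mu> = 1 / \<kappa>\<close>.
\<close>

lemma transfer_limit:
  fixes c0 a :: complex and p :: nat and \<mu> :: complex and x :: "complex \<Rightarrow> complex"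
  assumes per: "(quad c0 ^^ p) a = a" and rep: "norm (space_deriv c0 a p) > 1"
  defines "\<rho> \<equiv> space_deriv c0 a p"
  defines "\<sigma> \<equiv> param_deriv c0 a p / (\<rho> - 1)"
  assumes s: "strict_mono (s :: nat \<Rightarrow> nat)"
    and lim: "\<And>R. uniform_limit (cball 0 R) (\<lambda>k w. (quad c0 ^^ (p * s k)) (a + w / \<rho> ^ s k)) \<phi> sequentially"
    and C: "C \<ge> 0" and \<delta>: "\<delta> > 0"
    and x: "\<And>h. norm h \<le> \<delta> \<Longrightarrow> norm (x h - (a + h - \<sigma> * (\<mu> * h))) \<le> C * (norm h)\<^sup>2"
  shows "uniform_limit (cball 0 R)
    (\<lambda>k w. (quad (c0 + \<mu> * (w / \<rho> ^ s k)) ^^ (p * s k)) (x (w / \<rho> ^ s k))) \<phi> sequentially"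
  unfolding uniform_limit_iff
proof (intro allI impI)
  fix \<epsilon> :: real assume \<epsilon>: "\<epsilon> > 0"
  define W where "W = \<bar>R\<bar> + 1"
  have W: "W > 0" by (simp add: W_def)
  define r where "r = norm \<rho>"
  have r: "r > 1" using rep by (simp add: r_def \<rho>_def)
  have "norm \<mu> * W \<ge> 0" "C * W\<^sup>2 \<ge> 0" using W C by auto
  from rescaled_iterates_close[OF per rep W this, folded \<rho>_def, folded \<sigma>_def r_def]
  obtain M where "\<forall>\<epsilon>>0. \<exists>n1. \<forall>n\<ge>n1. \<forall>w u v.
      norm w \<le> W \<longrightarrow> norm u \<le> norm \<mu> * W / r ^ n \<longrightarrow>
      norm (v - (a + w / \<rho> ^ n - \<sigma> * u)) \<le> C * W\<^sup>2 / (r ^ n)\<^sup>2 \<longrightarrow>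
      norm ((quad (c0 + u) ^^ (p * n)) v - (quad c0 ^^ (p * n)) (a + w / \<rho> ^ n)) < \<epsilon> \<and>
      norm ((quad c0 ^^ (p * n)) (a + w / \<rho> ^ n)) \<le> M" .
  from this[THEN spec, THEN mp, OF half_gt_zero[OF \<epsilon>]]
  obtain n1 where n1: "\<forall>n\<ge>n1. \<forall>w u v.
      norm w \<le> W \<longrightarrow> norm u \<le> norm \<mu> * W / r ^ n \<longrightarrow>
      norm (v - (a + w / \<rho> ^ n - \<sigma> * u)) \<le> C * W\<^sup>2 / (r ^ n)\<^sup>2 \<longrightarrow>
      norm ((quad (c0 + u) ^^ (p * n)) v - (quad c0 ^^ (p * n)) (a + w / \<rho> ^ n)) < \<epsilon> / 2 \<and>
      norm ((quad c0 ^^ (p * n)) (a + w / \<rho> ^ n)) \<le> M" ..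
  have "(\<lambda>n. W * inverse r ^ n) \<longlonglongrightarrow> W * 0"
    using r by (intro tendsto_mult tendsto_const LIMSEQ_power_zero) (auto simp: field_simps)
  then have "\<forall>\<^sub>F n in sequentially. W * inverse r ^ n < \<delta>"
    using \<delta> by (intro order_tendstoD(2)) auto
  then obtain n2 where n2: "\<And>n. n \<ge> n2 \<Longrightarrow> W / r ^ n < \<delta>"
    by (auto simp: eventually_sequentially power_inverse divide_inverse)
  have "\<forall>\<^sub>F k in sequentially. \<forall>w\<in>cball 0 R. dist ((quad c0 ^^ (p * s k)) (a + w / \<rho> ^ s k)) (\<phi> w) < \<epsilon> / 2"
    using uniform_limitD[OF lim[of R], of "\<epsilon> / 2"] \<epsilon> by simp
  moreover have "\<forall>\<^sub>F k in sequentially. k \<ge> max n1 n2"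
    by (rule eventually_ge_at_top)
  ultimately show "\<forall>\<^sub>F k in sequentially. \<forall>w\<in>cball 0 R.
      dist ((quad (c0 + \<mu> * (w / \<rho> ^ s k)) ^^ (p * s k)) (x (w / \<rho> ^ s k))) (\<phi> w) < \<epsilon>"
  proof eventually_elim
    case (elim k)
    define n where "n = s k"
    have n: "n \<ge> n1" "n \<ge> n2" using elim(2) seq_suble[OF s, of k] by (auto simp: n_def)
    show ?case
    proof
      fix w :: complex assume w: "w \<in> cball 0 R"
      then have wW: "norm w \<le> W" by (simp add: W_def)
      define h where "h = w / \<rho> ^ n"
      have h: "norm h \<le> W / r ^ n"
        using wW r by (simp add: h_def norm_divide norm_power r_def divide_right_mono)
      then have "norm h \<le> \<delta>" using n2[OF n(2)] by linarith
      have "norm (x h - (a + h - \<sigma> * (\<mu> * h))) \<le> C * (norm h)\<^sup>2" using x \<open>norm h \<le> \<delta>\<close> by blast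
      also have "\<dots> \<le> C * (W / r ^ n)\<^sup>2" using h C by (intro mult_left_mono power_mono) auto
      finally have "norm (x h - (a + w / \<rho> ^ n - \<sigma> * (\<mu> * h))) \<le> C * W\<^sup>2 / (r ^ n)\<^sup>2"
        by (simp add: h_def power_divide)
      moreover have "norm (\<mu> * h) \<le> norm \<mu> * W / r ^ n"
        using mult_left_mono[OF h norm_ge_zero[of \<mu>]] by (simp add: norm_mult)
      ultimately have "norm ((quad (c0 + \<mu> * h) ^^ (p * n)) (x h) - (quad c0 ^^ (p * n)) (a + w / \<rho> ^ n)) < \<epsilon> / 2"
        using n1 n(1) wW by blast
      moreover have "norm ((quad c0 ^^ (p * n)) (a + w / \<rho> ^ n) - \<phi> w) < \<epsilon> / 2"
        using elim(1) w by (simp add: n_def dist_norm)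
      ultimately show "dist ((quad (c0 + \<mu> * (w / \<rho> ^ s k)) ^^ (p * s k)) (x (w / \<rho> ^ s k))) (\<phi> w) < \<epsilon>"
        unfolding n_def[symmetric] h_def[symmetric] dist_norm by norm
    qed
  qed
qed

lemma rescaling_tendsto_0:
  fixes \<rho> \<kappa> :: complex
  assumes "norm \<rho> > 1" and s: "strict_mono (s :: nat \<Rightarrow> nat)"
  shows "(\<lambda>k. \<kappa> / \<rho> ^ s k) \<longlonglongrightarrow> 0"
proof -
  have "(\<lambda>n. \<kappa> * inverse \<rho> ^ n) \<longlonglongrightarrow> \<kappa> * 0"
    using assms(1)
    by (intro tendsto_mult tendsto_const LIMSEQ_power_zero) (auto simp: norm_inverse inverse_less_1_iff)
  from LIMSEQ_subseq_LIMSEQ[OF this s] show ?thesis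
    by (simp add: comp_def power_inverse divide_inverse)
qed

theorem theorem8:
  fixes c0 :: complex
  assumes "misiurewicz c0"
  shows "\<exists>\<phi>. \<phi> nicely_meromorphic_on UNIV \<and> \<not> \<phi> constant_on UNIV \<and>
           \<phi> \<in> zalcman_dynamical c0 c0 \<inter> zalcman_parameter c0"
proof -
  obtain l p where p: "p \<ge> 1"
    and per: "(quad c0 ^^ p) ((quad c0 ^^ l) c0) = (quad c0 ^^ l) c0"
    and "norm (deriv (quad c0 ^^ p) ((quad c0 ^^ l) c0)) > 1"
    using assms unfolding misiurewicz_def repelling_periodic_def by blast
  define a where "a = (quad c0 ^^ l) c0"
  define \<rho> where "\<rho> = space_deriv c0 a p"
  have rep: "norm (space_deriv c0 a p) > 1"
    using \<open>norm (deriv _ _) > 1\<close> DERIV_imp_deriv[OF has_field_derivative_iterate]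
    by (simp add: a_def)
  then have \<rho>: "norm \<rho> > 1" by (simp add: \<rho>_def)
  then have \<rho>0: "\<rho> \<noteq> 0" "\<rho> \<noteq> 1" by auto
  have per_a: "(quad c0 ^^ p) a = a" using per by (simp add: a_def)
  \<comment> \<open>Starting at the critical point lets \<open>param_deriv\<close> with a fixed starting point describe the family \<open>f\<^bsub>c\<^esub>\<^sup>l(c)\<close>.\<close>
  have shift: "(quad c ^^ n) c = (quad c ^^ Suc n) 0" for c n
  proof -
    have "(quad c ^^ Suc n) 0 = (quad c ^^ n) (quad c 0)" by (simp only: funpow_Suc_right comp_apply)
    then show ?thesis by (simp only: quad_def) simp
  qed
  have a: "a = (quad c0 ^^ Suc l) 0" unfolding a_def by (rule shift)
  have nz: "(quad c0 ^^ i) c0 \<noteq> 0" for i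
    using critical_orbit_nonzero[of p c0 l i] per_a p \<rho>0(1)
    unfolding shift a[symmetric] \<rho>_def by blast
  define \<beta> where "\<beta> = space_deriv c0 c0 l"
  have \<beta>: "\<beta> \<noteq> 0" using nz by (simp add: \<beta>_def space_deriv_nonzero_iff)
  define \<sigma> where "\<sigma> = param_deriv c0 a p / (\<rho> - 1)"
  have \<sigma>: "\<sigma> * (\<rho> - 1) = param_deriv c0 a p" using \<rho>0(2) by (simp add: \<sigma>_def)
  define \<kappa> where "\<kappa> = param_deriv c0 0 (Suc l) + \<sigma>"
  have "param_deriv c0 0 (Suc l + p) \<noteq> param_deriv c0 0 (Suc l)"
  proof (rule transversality[OF _ p])
    show "(quad c0 ^^ Suc i) 0 \<noteq> 0" for i using nz[of i] unfolding shift .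
    show "(quad c0 ^^ (Suc l + p)) 0 = (quad c0 ^^ Suc l) 0"
      using per_a unfolding a by (metis add.commute comp_apply funpow_add)
  qed
  moreover have "param_deriv c0 0 (Suc l + p) = \<rho> * param_deriv c0 0 (Suc l) + param_deriv c0 a p"
    unfolding param_deriv_add a[symmetric] \<rho>_def ..
  moreover have "\<kappa> * (\<rho> - 1) = \<rho> * param_deriv c0 0 (Suc l) + param_deriv c0 a p - param_deriv c0 0 (Suc l)"
    unfolding \<sigma>[symmetric] \<kappa>_def by (simp add: algebra_simps del: param_deriv.simps)
  ultimately have \<kappa>: "\<kappa> \<noteq> 0" by auto
  obtain \<phi> s where \<phi>: "\<phi> holomorphic_on UNIV" "\<not> \<phi> constant_on UNIV"
    and s: "strict_mono (s :: nat \<Rightarrow> nat)"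
    and "\<forall>R. uniform_limit (cball 0 R) (\<lambda>k w. (quad c0 ^^ (p * s k)) (a + w / \<rho> ^ s k)) \<phi> sequentially"
    by (rule exists_common_limit[OF per_a rep, folded \<rho>_def])
  then have lim: "\<And>R. uniform_limit (cball 0 R) (\<lambda>k w. (quad c0 ^^ (p * s k)) (a + w / \<rho> ^ s k)) \<phi> sequentially"
    by blast
  have iter: "(quad c ^^ (l + p * n)) z = (quad c ^^ (p * n)) ((quad c ^^ l) z)" for c n z
    by (metis add.commute comp_apply funpow_add)
  have "\<phi> \<in> zalcman (range (\<lambda>n z. (quad c0 ^^ n) z)) c0"
  proof (rule zalcmanI[OF \<phi>, where F = "\<lambda>k z. (quad c0 ^^ (l + p * s k)) z" and \<alpha> = "\<lambda>k. (1 / \<beta>) / \<rho> ^ s k"])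
    obtain C where C: "C \<ge> 0" and est: "\<And>c x y. norm (c - c0) \<le> 1 \<Longrightarrow> norm (x - c0) \<le> 1 \<Longrightarrow> norm (y - c0) \<le> 1 \<Longrightarrow>
      norm ((quad c ^^ l) x - (quad c0 ^^ l) y - \<beta> * (x - y) - param_deriv c0 c0 l * (c - c0))
        \<le> C * (norm (c - c0) + norm (x - c0) + norm (y - c0)) * (norm (x - y) + norm (c - c0))"
      using iterate_expansion[of c0 c0 l] unfolding \<beta>_def by blast
    define x where "x = (\<lambda>h. (quad c0 ^^ l) (c0 + h / \<beta>))"
    have x: "norm (x h - (a + h - \<sigma> * (0 * h))) \<le> C / (norm \<beta>)\<^sup>2 * (norm h)\<^sup>2"
      if "norm h \<le> norm \<beta>" for h
      using est[of c0 "c0 + h / \<beta>" c0] that \<beta>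
      by (simp add: x_def norm_divide a_def power2_eq_square diff_diff_eq)
    have "uniform_limit (cball 0 R) (\<lambda>k w. (quad (c0 + 0 * (w / \<rho> ^ s k)) ^^ (p * s k))
        (x (w / \<rho> ^ s k))) \<phi> sequentially" for R
      by (rule transfer_limit[OF per_a rep s, folded \<rho>_def, folded \<sigma>_def, OF lim _ _ x]) (use C \<beta> in auto)
    then show "uniform_limit (cball 0 R)
        (\<lambda>k w. (quad c0 ^^ (l + p * s k)) (1 / \<beta> / \<rho> ^ s k * w + c0)) \<phi> sequentially" for R
      by (simp add: iter x_def add.commute mult.commute)
  qed (use \<beta> \<rho>0 rescaling_tendsto_0[OF \<rho> s] holomorphic_on_iterate in \<open>auto simp del: divide_divide_eq_left\<close>)
  moreover have "\<phi> \<in> zalcman (range (\<lambda>n c. (quad c ^^ n) c)) c0"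
  proof (rule zalcmanI[OF \<phi>, where F = "\<lambda>k c. (quad c ^^ (l + p * s k)) c" and \<alpha> = "\<lambda>k. (1 / \<kappa>) / \<rho> ^ s k"])
    define x where "x = (\<lambda>h. (quad (c0 + 1 / \<kappa> * h) ^^ l) (c0 + 1 / \<kappa> * h))"
    obtain C where C: "C \<ge> 0" and est: "\<And>c x y. norm (c - c0) \<le> 1 \<Longrightarrow> norm (x - 0) \<le> 1 \<Longrightarrow> norm (y - 0) \<le> 1 \<Longrightarrow>
      norm ((quad c ^^ Suc l) x - (quad c0 ^^ Suc l) y - space_deriv c0 0 (Suc l) * (x - y) - param_deriv c0 0 (Suc l) * (c - c0))
        \<le> C * (norm (c - c0) + norm (x - 0) + norm (y - 0)) * (norm (x - y) + norm (c - c0))"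
      using iterate_expansion[of c0 0 "Suc l"] by blast
    have x: "norm (x h - (a + h - \<sigma> * (1 / \<kappa> * h))) \<le> C / (norm \<kappa>)\<^sup>2 * (norm h)\<^sup>2"
      if "norm h \<le> norm \<kappa>" for h
    proof -
      define u where "u = 1 / \<kappa> * h"
      have u: "norm u \<le> 1" "norm u = norm h / norm \<kappa>" "h = \<kappa> * u"
        using that \<kappa> by (auto simp: u_def norm_mult norm_divide)
      have "norm (x h - a - param_deriv c0 0 (Suc l) * u) \<le> C * norm u * norm u"
        using est[of "c0 + u" 0 0] u(1) unfolding x_def u_def[symmetric] shift a by simp
      moreover have "x h - (a + h - \<sigma> * u) = x h - a - param_deriv c0 0 (Suc l) * u"
        unfolding u(3) \<kappa>_def by (simp only: distrib_right) (simp del: param_deriv.simps)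
      ultimately show ?thesis
        unfolding u_def[symmetric] by (simp only: u(2)) (simp add: power2_eq_square)
    qed
    have "uniform_limit (cball 0 R) (\<lambda>k w. (quad (c0 + 1 / \<kappa> * (w / \<rho> ^ s k)) ^^ (p * s k))
        (x (w / \<rho> ^ s k))) \<phi> sequentially" for R
      by (rule transfer_limit[OF per_a rep s, folded \<rho>_def, folded \<sigma>_def, OF lim _ _ x]) (use C \<kappa> in auto)
    then show "uniform_limit (cball 0 R)
        (\<lambda>k w. (quad (1 / \<kappa> / \<rho> ^ s k * w + c0) ^^ (l + p * s k)) (1 / \<kappa> / \<rho> ^ s k * w + c0)) \<phi> sequentially" for R
      by (simp add: iter x_def add.commute mult.commute)
  qed (use \<kappa> \<rho>0 rescaling_tendsto_0[OF \<rho> s] holomorphic_on_iterate_diagonal in \<open>auto simp del: divide_divide_eq_left\<close>)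
  ultimately have "\<phi> \<in> zalcman_dynamical c0 c0 \<inter> zalcman_parameter c0"
    by (simp add: zalcman_dynamical_def zalcman_parameter_def)
  then show ?thesis using \<phi>(2) by (auto simp: zalcman_parameter_def zalcman_def)
qed

end
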